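(* Let $\epsilon^*>0$ and let $M,T,X,\mu,X_\epsilon,Y'_\epsilon,Y_\epsilon,\mathcal{L}_\epsilon$ ($0<\epsilon\le\epsilon^*$) be as in the context. Suppose that $T:X\to Y_0=T(X)$ is nonsingular, that $Y_0$ is a smooth manifold with smooth boundary, that $T^{-1}$ is smooth, and that $\mu$ is supported on $X$ and absolutely continuous with density bounded above and below (by positive finite constants on $X$). Let $\sigma_{2,\epsilon}$ denote the second singular value of $\mathcal{L}_\epsilon$. Then there exists $0<C<\infty$ such that $$1-\sigma_{2,\epsilon}\le C\epsilon\qquad\text{for all }0<\epsilon<\epsilon^*.$$
   Context: $M\subset\mathbb{R}^d$ is compact, $\ell$ is Lebesgue measure, $B_\epsilon(x)$ is the Euclidean ball of radius $\epsilon$ centred at $x$, $T:M\to M$ is a map and $X\subset M$; nonsingular means $\ell(T^{-1}A)=0$ whenever $\ell(A)=0$. $\mu$ is a probability measure on $X$ with density $h_\mu\in L^2(X,\ell)$. For $0<\epsilon\le\epsilon^*$ put $\alpha_\epsilon=\mathbf{1}_{B_\epsilon(0)}/\ell(B_\epsilon(0))$; let $\mathcal{D}_{X,\epsilon}g(y)=\int_X\alpha_\epsilon(y-x)g(x)\,dx$, $X_\epsilon=\mathrm{supp}(\mathcal{D}_{X,\epsilon}\mathbf{1}_X)$, $Y'_\epsilon=T(X_\epsilon)$, $\mathcal{D}_{Y'_\epsilon,\epsilon}g(y)=\int_{Y'_\epsilon}\alpha_\epsilon(y-x)g(x)\,dx$ and $Y_\epsilon=\mathrm{supp}(\mathcal{D}_{Y'_\epsilon,\epsilon}\mathbf{1}_{Y'_\epsilon})$.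 It is assumed that $X_\epsilon,Y_\epsilon\subset M$, that $B_\epsilon(x)\subset X_\epsilon$ for $x\in X$ and $B_\epsilon(Tz)\subset Y_\epsilon$ for $z\in X_\epsilon$, and that the inverse $T^{-1}$ is defined (and smooth) on $T(X_{\epsilon^*})$, where it is used. Define, for $y\in Y_\epsilon$, $$h_{\nu_\epsilon}(y)=\int_X\Big(\int_{X_\epsilon}\alpha_\epsilon(y-Tz)\alpha_\epsilon(z-x)\,dz\Big)h_\mu(x)\,dx,$$ let $\nu_\epsilon$ be the measure on $Y_\epsilon$ with Lebesgue density $h_{\nu_\epsilon}$, and define the compact operator $\mathcal{L}_\epsilon:L^2(X,\mu)\to L^2(Y_\epsilon,\nu_\epsilon)$ by $$\mathcal{L}_\epsilon f(y)=\frac{1}{h_{\nu_\epsilon}(y)}\int_X\Big(\int_{X_\epsilon}\alpha_\epsilon(y-Tz)\alpha_\epsilon(z-x)\,dz\Big)f(x)h_\mu(x)\,dx .$$ The singular values of $\mathcal{L}_\epsilon$ are the square roots of the eigenvalues of $\mathcal{L}_\epsilon^*\mathcal{L}_\epsilon$ in decreasing order, repeated by multiplicity; $\sigma_{2,\epsilon}$ is the second of these. *)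

theory Defs
  imports "HOL-Probability.Probability_Measure"
begin

section \<open>Smooth maps and smooth manifolds with boundary in Euclidean space\<close>

fun Ck_on :: "nat \<Rightarrow> 'a::euclidean_space set \<Rightarrow> ('a \<Rightarrow> 'b::euclidean_space) \<Rightarrow> bool" where
  "Ck_on 0 U g \<longleftrightarrow> continuous_on U g"
| "Ck_on (Suc k) U g \<longleftrightarrow>
     (\<forall>x\<in>U. g differentiable (at x)) \<and> (\<forall>v. Ck_on k U (\<lambda>x. frechet_derivative g (at x) v))"

text \<open>\<^const>\<open>Ck_on\<close> is meant for open sets. On an arbitrary set, a map is smooth if it extends
  locally to a smooth map on an open set.\<close>

definition smooth_on :: "'a::euclidean_space set \<Rightarrow> ('a \<Rightarrow> 'b::euclidean_space) \<Rightarrow> bool" where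
  "smooth_on S f \<longleftrightarrow>
     (\<forall>x\<in>S. \<exists>U g. open U \<and> x \<in> U \<and> (\<forall>k. Ck_on k U g) \<and> (\<forall>y\<in>S \<inter> U. g y = f y))"

text \<open>Charts straighten \<open>S\<close> to a relatively open piece of the half-space \<open>v \<bullet> e \<ge> 0\<close> of a
  \<open>k\<close>-dimensional subspace \<open>H\<close>; the case \<open>e = 0\<close> gives charts without boundary.\<close>

definition smooth_manifold_with_boundary :: "nat \<Rightarrow> 'a::euclidean_space set \<Rightarrow> bool" where
  "smooth_manifold_with_boundary k S \<longleftrightarrow>
     (\<forall>p\<in>S. \<exists>(U::'a set) (V::'a set) \<phi> \<psi> H e.
        open U \<and> p \<in> U \<and> open V \<and> homeomorphism U V \<phi> \<psi> \<and> smooth_on U \<phi> \<and> smooth_on V \<psi> \<and>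
        subspace H \<and> dim H = k \<and> e \<in> H \<and>
        \<phi> ` (S \<inter> U) = V \<inter> {v \<in> H. v \<bullet> e \<ge> 0})"

definition nonsingular_on :: "'a::euclidean_space set \<Rightarrow> ('a \<Rightarrow> 'a) \<Rightarrow> bool" where
  "nonsingular_on X T \<longleftrightarrow>
     (\<forall>A \<in> null_sets lebesgue. {x \<in> X. T x \<in> A} \<in> null_sets lebesgue)"

section \<open>Operators between real \<open>L\<^sup>2\<close> spaces and their singular values\<close>

text \<open>Elements of \<open>L\<^sup>2\<close> are represented by functions; identification up to null sets is made
  explicit wherever it matters.\<close>

definition L2 :: "'a measure \<Rightarrow> ('a \<Rightarrow> real) set" where
  "L2 M = {f \<in> borel_measurable M. integrable M (\<lambda>x. (f x)\<^sup>2)}"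

definition L2_inner :: "'a measure \<Rightarrow> ('a \<Rightarrow> real) \<Rightarrow> ('a \<Rightarrow> real) \<Rightarrow> real" where
  "L2_inner M f g = (\<integral>x. f x * g x \<partial>M)"

definition is_L2_adjoint ::
  "'a measure \<Rightarrow> 'b measure \<Rightarrow> (('a \<Rightarrow> real) \<Rightarrow> 'b \<Rightarrow> real) \<Rightarrow> (('b \<Rightarrow> real) \<Rightarrow> 'a \<Rightarrow> real) \<Rightarrow> bool" where
  "is_L2_adjoint M N A B \<longleftrightarrow>
     (\<forall>g\<in>L2 N. B g \<in> L2 M) \<and>
     (\<forall>f\<in>L2 M. \<forall>g\<in>L2 N. L2_inner N (A f) g = L2_inner M f (B g))"

text \<open>For each \<open>g\<close> in \<open>L2 N\<close>, the function \<open>B g\<close> is determined up to a null set.\<close>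

definition L2_adjoint ::
  "'a measure \<Rightarrow> 'b measure \<Rightarrow> (('a \<Rightarrow> real) \<Rightarrow> 'b \<Rightarrow> real) \<Rightarrow> ('b \<Rightarrow> real) \<Rightarrow> 'a \<Rightarrow> real" where
  "L2_adjoint M N A = (SOME B. is_L2_adjoint M N A B)"

definition L2_eigenspace ::
  "'a measure \<Rightarrow> (('a \<Rightarrow> real) \<Rightarrow> 'a \<Rightarrow> real) \<Rightarrow> real \<Rightarrow> ('a \<Rightarrow> real) set" where
  "L2_eigenspace M A l = {f \<in> L2 M. AE x in M. A f x = l * f x}"

definition L2_independent :: "'a measure \<Rightarrow> nat \<Rightarrow> (nat \<Rightarrow> 'a \<Rightarrow> real) \<Rightarrow> bool" where
  "L2_independent M n e \<longleftrightarrow>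
     (\<forall>c. (AE x in M. (\<Sum>i<n. c i * e i x) = 0) \<longrightarrow> (\<forall>i<n. c i = (0::real)))"

text \<open>The dimension of the eigenspace modulo null functions: \<open>0\<close> if \<open>l\<close> is not an eigenvalue,
  possibly \<open>\<infinity>\<close>.\<close>

definition eigenvalue_mult ::
  "'a measure \<Rightarrow> (('a \<Rightarrow> real) \<Rightarrow> 'a \<Rightarrow> real) \<Rightarrow> real \<Rightarrow> enat" where
  "eigenvalue_mult M A l =
     (SUP n \<in> {n. \<exists>e. (\<forall>i<n. e i \<in> L2_eigenspace M A l) \<and> L2_independent M n e}. enat n)"

text \<open>\<open>l\<close> is entry number \<open>k\<close> (counting from \<open>1\<close>) of the list of eigenvalues in decreasing order,
  repeated by multiplicity, iff fewer than \<open>k\<close> entries are greater than \<open>l\<close> and at least \<open>k\<close>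
  entries are greater than or equal to \<open>l\<close>.\<close>

definition is_nth_eigenvalue ::
  "'a measure \<Rightarrow> (('a \<Rightarrow> real) \<Rightarrow> 'a \<Rightarrow> real) \<Rightarrow> nat \<Rightarrow> real \<Rightarrow> bool" where
  "is_nth_eigenvalue M A k l \<longleftrightarrow>
     (\<Sum>\<^sub>\<infinity>m\<in>{l<..}. eigenvalue_mult M A m) < enat k \<and>
     enat k \<le> (\<Sum>\<^sub>\<infinity>m\<in>{l..}. eigenvalue_mult M A m)"

lemma is_nth_eigenvalue_unique:
  assumes "is_nth_eigenvalue M A k l" "is_nth_eigenvalue M A k l'"
  shows "l = l'"
proof -
  have aux: "\<not> a < b" if "is_nth_eigenvalue M A k a" "is_nth_eigenvalue M A k b" for a b
  proof
    assume "a < b"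
    have "(\<Sum>\<^sub>\<infinity>m\<in>{b..}. eigenvalue_mult M A m) \<le> (\<Sum>\<^sub>\<infinity>m\<in>{a<..}. eigenvalue_mult M A m)"
      by (rule infsum_mono_neutral) (use \<open>a < b\<close> in \<open>auto intro: nonneg_summable_on_complete\<close>)
    with that show False
      unfolding is_nth_eigenvalue_def by (meson leD order_trans)
  qed
  show ?thesis
    using aux[OF assms] aux[OF assms(2,1)] by simp
qed

definition nth_eigenvalue ::
  "'a measure \<Rightarrow> (('a \<Rightarrow> real) \<Rightarrow> 'a \<Rightarrow> real) \<Rightarrow> nat \<Rightarrow> real" where
  "nth_eigenvalue M A k = (THE l. is_nth_eigenvalue M A k l)"

definition singular_value ::
  "'a measure \<Rightarrow> 'b measure \<Rightarrow> (('a \<Rightarrow> real) \<Rightarrow> 'b \<Rightarrow> real) \<Rightarrow> nat \<Rightarrow> real" where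
  "singular_value M N A k = sqrt (nth_eigenvalue M (\<lambda>f. L2_adjoint M N A (A f)) k)"

section \<open>The diffusively smoothed transfer operator\<close>

definition alpha :: "real \<Rightarrow> 'a::euclidean_space \<Rightarrow> real" where
  "alpha \<epsilon> x = indicator (ball 0 \<epsilon>) x / measure lebesgue (ball (0::'a) \<epsilon>)"

definition diffusion ::
  "'a::euclidean_space set \<Rightarrow> real \<Rightarrow> ('a \<Rightarrow> real) \<Rightarrow> 'a \<Rightarrow> real" where
  "diffusion X \<epsilon> g y = (LINT x:X|lebesgue. alpha \<epsilon> (y - x) * g x)"

definition supp :: "('a::topological_space \<Rightarrow> real) \<Rightarrow> 'a set" where
  "supp g = closure {x. g x \<noteq> 0}"

definition X_eps :: "'a::euclidean_space set \<Rightarrow> real \<Rightarrow> 'a set" where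
  "X_eps X \<epsilon> = supp (diffusion X \<epsilon> (indicator X))"

definition Y'_eps :: "'a::euclidean_space set \<Rightarrow> ('a \<Rightarrow> 'a) \<Rightarrow> real \<Rightarrow> 'a set" where
  "Y'_eps X T \<epsilon> = T ` X_eps X \<epsilon>"

definition Y_eps :: "'a::euclidean_space set \<Rightarrow> ('a \<Rightarrow> 'a) \<Rightarrow> real \<Rightarrow> 'a set" where
  "Y_eps X T \<epsilon> = supp (diffusion (Y'_eps X T \<epsilon>) \<epsilon> (indicator (Y'_eps X T \<epsilon>)))"

definition kernel ::
  "'a::euclidean_space set \<Rightarrow> ('a \<Rightarrow> 'a) \<Rightarrow> real \<Rightarrow> 'a \<Rightarrow> 'a \<Rightarrow> real" where
  "kernel X T \<epsilon> x y = (LINT z:X_eps X \<epsilon>|lebesgue. alpha \<epsilon> (y - T z) * alpha \<epsilon> (z - x))"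

definition mu :: "'a::euclidean_space set \<Rightarrow> ('a \<Rightarrow> real) \<Rightarrow> 'a measure" where
  "mu X h = density (lebesgue_on X) (\<lambda>x. ennreal (h x))"

definition h_nu ::
  "'a::euclidean_space set \<Rightarrow> ('a \<Rightarrow> real) \<Rightarrow> ('a \<Rightarrow> 'a) \<Rightarrow> real \<Rightarrow> 'a \<Rightarrow> real" where
  "h_nu X h T \<epsilon> y = (LINT x:X|lebesgue. kernel X T \<epsilon> x y * h x)"

definition nu ::
  "'a::euclidean_space set \<Rightarrow> ('a \<Rightarrow> real) \<Rightarrow> ('a \<Rightarrow> 'a) \<Rightarrow> real \<Rightarrow> 'a measure" where
  "nu X h T \<epsilon> = density (lebesgue_on (Y_eps X T \<epsilon>)) (\<lambda>y. ennreal (h_nu X h T \<epsilon> y))"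

text \<open>Where \<^term>\<open>h_nu X h T \<epsilon>\<close> vanishes, a null set for \<^term>\<open>nu X h T \<epsilon>\<close>, the value is \<open>0\<close>.\<close>

definition L_eps ::
  "'a::euclidean_space set \<Rightarrow> ('a \<Rightarrow> real) \<Rightarrow> ('a \<Rightarrow> 'a) \<Rightarrow> real \<Rightarrow> ('a \<Rightarrow> real) \<Rightarrow> 'a \<Rightarrow> real" where
  "L_eps X h T \<epsilon> f y =
     1 / h_nu X h T \<epsilon> y * (LINT x:X|lebesgue. kernel X T \<epsilon> x y * f x * h x)"

definition sigma2 ::
  "'a::euclidean_space set \<Rightarrow> ('a \<Rightarrow> real) \<Rightarrow> ('a \<Rightarrow> 'a) \<Rightarrow> real \<Rightarrow> real" where
  "sigma2 X h T \<epsilon> = singular_value (mu X h) (nu X h T \<epsilon>) (L_eps X h T \<epsilon>) 2"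

end

theory Submission
  imports Defs "HOL-Complex_Analysis.Great_Picard"
begin

text \<open>The second eigenvalue of the compact operator \<open>L\<^sup>*L\<close> is the maximum of \<open>\<parallel>L f\<parallel>\<^sup>2 / \<parallel>f\<parallel>\<^sup>2\<close> over
  \<open>f\<close> orthogonal to the constants, which are the first singular functions because \<open>L\<close> is Markov.
  Under the joint law \<open>P\<close> of start point \<open>x\<close> and end point \<open>y\<close>, the function \<open>L f\<close> is the conditional
  expectation of \<open>f(x)\<close> given \<open>y\<close>, so that \<open>\<parallel>f\<parallel>\<^sup>2 - \<parallel>L f\<parallel>\<^sup>2 \<le> \<integral> (f(x) - g(y))\<^sup>2 dP\<close> for every \<open>g\<close>. Both jumps of
  the diffusion have length less than \<open>\<epsilon>\<close>; hence a nonconstant Lipschitz pair with \<open>f = g \<circ> T\<close> makes the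
  right-hand side \<open>O(\<epsilon>\<^sup>2)\<close>. Such a pair exists since \<open>T(X)\<close> has an interior point: a manifold of lower
  dimension would be null, contradicting nonsingularity.\<close>

section \<open>The space of square-integrable functions\<close>

text \<open>Two obstacles shape the argument. The first lies in the definition of the singular
  value: \<open>nth_eigenvalue\<close> is a definite description in a list counted with
  multiplicity, so Rayleigh quotients say nothing about it until the supremum on the complement of
  the constants is known to be attained and the eigenspaces above it have been counted. Compactness
  is proved for this purpose only. The second is regularity: \<open>T\<close> itself is merely
  measurable, and smoothness is given for its inverse. Hence compactness is drawn from the first
  diffusion, which acts before \<open>T\<close>: it averages over balls whose normalised indicators
  move continuously in \<open>L2\<close>, and the rest of the operator only has to respect pointwise
  limits. The test pair is fixed once, from the data at \<open>eps_star\<close>, so that neither its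
  Lipschitz constant nor its variance depends on \<epsilon>. The energy estimate is then quadratic
  in \<epsilon>, and the linear rate results from replacing one factor \<epsilon> by
  \<open>eps_star\<close>.\<close>

lemma abs_mult_le_sum_squares: "\<bar>a * b\<bar> \<le> a\<^sup>2 + (b :: real)\<^sup>2"
proof -
  have "2 * \<bar>a * b\<bar> \<le> a\<^sup>2 + b\<^sup>2"
    using sum_squares_bound[of "\<bar>a\<bar>" "\<bar>b\<bar>"] by (simp add: abs_mult)
  then show ?thesis by simp
qed

lemma L2D [dest]:
  assumes "f \<in> L2 M"
  shows "f \<in> borel_measurable M" "integrable M (\<lambda>x. (f x)\<^sup>2)"
  using assms by (auto simp: L2_def)

lemma L2_mult_integrable:
  assumes "f \<in> L2 M" "g \<in> L2 M"
  shows "integrable M (\<lambda>x. f x * g x)"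
proof (rule Bochner_Integration.integrable_bound)
  note [measurable] = L2D(1)[OF assms(1)] L2D(1)[OF assms(2)]
  show "integrable M (\<lambda>x. (f x)\<^sup>2 + (g x)\<^sup>2)"
    using assms by (intro Bochner_Integration.integrable_add) auto
  show "(\<lambda>x. f x * g x) \<in> borel_measurable M" by measurable
  show "AE x in M. norm (f x * g x) \<le> norm ((f x)\<^sup>2 + (g x)\<^sup>2)"
    using abs_mult_le_sum_squares by auto
qed

lemma L2_lincomb:
  assumes "f \<in> L2 M" "g \<in> L2 M"
  shows "(\<lambda>x. a * f x + b * g x) \<in> L2 M"
proof -
  note [measurable] = L2D(1)[OF assms(1)] L2D(1)[OF assms(2)]
  have "integrable M (\<lambda>x. a\<^sup>2 * (f x)\<^sup>2 + 2 * a * b * (f x * g x) + b\<^sup>2 * (g x)\<^sup>2)"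
    using assms L2_mult_integrable[OF assms]
    by (intro Bochner_Integration.integrable_add integrable_mult_right) auto
  moreover have "a\<^sup>2 * (f x)\<^sup>2 + 2 * a * b * (f x * g x) + b\<^sup>2 * (g x)\<^sup>2 = (a * f x + b * g x)\<^sup>2" for x
    by (simp add: power2_eq_square algebra_simps)
  ultimately show ?thesis by (simp add: L2_def)
qed

lemma L2_scale: "f \<in> L2 M \<Longrightarrow> (\<lambda>x. a * f x) \<in> L2 M"
  using L2_lincomb[of f M f a 0] by simp

lemma L2_const: "finite_measure M \<Longrightarrow> (\<lambda>_. c) \<in> L2 M"
  by (simp add: L2_def finite_measure.integrable_const)

lemma L2_inner_commute: "L2_inner M f g = L2_inner M g f"
  by (simp add: L2_inner_def mult.commute)

lemma L2_inner_lincomb_left: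
  assumes "f \<in> L2 M" "g \<in> L2 M" "u \<in> L2 M"
  shows "L2_inner M (\<lambda>x. a * f x + b * g x) u = a * L2_inner M f u + b * L2_inner M g u"
proof -
  have "L2_inner M (\<lambda>x. a * f x + b * g x) u = (\<integral>x. a * (f x * u x) + b * (g x * u x) \<partial>M)"
    unfolding L2_inner_def by (simp add: algebra_simps)
  then show ?thesis
    unfolding L2_inner_def
    using L2_mult_integrable[OF assms(1,3)] L2_mult_integrable[OF assms(2,3)] by simp
qed

lemma L2_inner_lincomb_right:
  assumes "f \<in> L2 M" "g \<in> L2 M" "u \<in> L2 M"
  shows "L2_inner M u (\<lambda>x. a * f x + b * g x) = a * L2_inner M u f + b * L2_inner M u g"
  using L2_inner_lincomb_left[OF assms] by (simp add: L2_inner_commute)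

lemma L2_inner_scale_left: "L2_inner M (\<lambda>x. a * f x) g = a * L2_inner M f g"
  by (simp add: L2_inner_def mult.assoc)

lemma L2_inner_scale_right: "L2_inner M f (\<lambda>x. a * g x) = a * L2_inner M f g"
  by (simp add: L2_inner_def mult.left_commute)

lemma L2_inner_lincomb_self:
  assumes "f \<in> L2 M" "g \<in> L2 M"
  shows "L2_inner M (\<lambda>x. a * f x + b * g x) (\<lambda>x. a * f x + b * g x) =
    a\<^sup>2 * L2_inner M f f + 2 * a * b * L2_inner M f g + b\<^sup>2 * L2_inner M g g"
  using assms
  by (simp add: L2_inner_lincomb_left L2_inner_lincomb_right L2_lincomb L2_inner_commute[of M g f]
      power2_eq_square algebra_simps)

lemma L2_inner_cong_AE:
  assumes "f \<in> borel_measurable M" "f' \<in> borel_measurable M" "u \<in> borel_measurable M"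
    "AE x in M. f x = f' x"
  shows "L2_inner M f u = L2_inner M f' u"
  unfolding L2_inner_def using assms by (intro integral_cong_AE) auto

lemma L2_inner_self_nonneg: "0 \<le> L2_inner M f f"
  by (simp add: L2_inner_def)

lemma L2_inner_self_eq_0_iff:
  assumes "f \<in> L2 M"
  shows "L2_inner M f f = 0 \<longleftrightarrow> (AE x in M. f x = 0)"
  unfolding L2_inner_def using integral_nonneg_eq_0_iff_AE[OF L2_mult_integrable[OF assms assms]] by simp

text \<open>First-order condition for a quadratic that vanishes at its minimum 0. It settles the
  degenerate case of Cauchy-Schwarz and yields the Euler-Lagrange equation of the Rayleigh
  quotient.\<close>

lemma linear_coeff_zero:
  fixes b c :: real
  assumes "\<And>t. 0 \<le> 2 * t * b + t\<^sup>2 * c"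
  shows "b = 0"
proof (rule ccontr)
  assume b: "b \<noteq> 0"
  \<comment> \<open>With this scale \<open>s * c\<close> stays below 1, so the quadratic is negative
    at \<open>- s * b\<close>; adding 1 covers \<open>c = 0\<close>.\<close>
  define s where "s = 1 / (\<bar>c\<bar> + 1)"
  have s: "0 < s" "s * \<bar>c\<bar> < 1"
    by (auto simp: s_def field_simps)
  have "0 \<le> 2 * (- s * b) * b + (- s * b)\<^sup>2 * c" by (rule assms)
  also have "\<dots> = s * b\<^sup>2 * (s * c - 2)" by (simp add: power2_eq_square algebra_simps)
  finally have "0 \<le> s * b\<^sup>2 * (s * c - 2)" .
  moreover have "s * c - 2 < 0"
  proof -
    have "s * c \<le> s * \<bar>c\<bar>" using s by (intro mult_left_mono) auto
    with s show ?thesis by linarith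
  qed
  moreover have "0 < s * b\<^sup>2" using s b by simp
  ultimately show False
    by (meson mult_pos_neg not_less)
qed

lemma L2_inner_Cauchy_Schwarz:
  assumes "f \<in> L2 M" "g \<in> L2 M"
  shows "(L2_inner M f g)\<^sup>2 \<le> L2_inner M f f * L2_inner M g g"
proof (cases "L2_inner M g g = 0")
  case True
  have "0 \<le> 2 * t * L2_inner M g f + t\<^sup>2 * L2_inner M f f" for t
    using L2_inner_self_nonneg[of M "\<lambda>x. 1 * g x + t * f x"] assms True
    by (subst (asm) L2_inner_lincomb_self) auto
  from linear_coeff_zero[OF this] True show ?thesis
    by (simp add: L2_inner_commute)
next
  case False
  define a where "a = L2_inner M g g"
  define b where "b = L2_inner M f g"
  have a: "a > 0" using False L2_inner_self_nonneg[of M g] by (simp add: a_def)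
  \<comment> \<open>Squared norm of the residual of \<open>f\<close> after projection to
    \<open>g\<close>, multiplied through by \<open>a\<close> to avoid a division.\<close>
  have "0 \<le> a\<^sup>2 * L2_inner M f f + 2 * a * (- b) * b + (- b)\<^sup>2 * a"
    using L2_inner_self_nonneg[of M "\<lambda>x. a * f x + (- b) * g x"]
    by (subst (asm) L2_inner_lincomb_self) (use assms in \<open>auto simp: a_def b_def\<close>)
  also have "\<dots> = a * (L2_inner M f f * a - b\<^sup>2)"
    by (simp add: power2_eq_square algebra_simps)
  finally show ?thesis
    using a by (simp add: zero_le_mult_iff a_def b_def)
qed

section \<open>Adjoints, eigenvalues and singular values\<close>

lemma L2_adjoint_is_adjoint:
  assumes "\<exists>B. is_L2_adjoint M N A B"
  shows "is_L2_adjoint M N A (L2_adjoint M N A)"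
  unfolding L2_adjoint_def using assms by (rule someI_ex)

text \<open>Operators that agree on \<open>L2 M\<close> have the same set of adjoints, hence the
  same chosen one. The actual operator and the abstract kernel operator are identified only on
  \<open>L2\<close>, where measurability is available.\<close>

lemma singular_value_cong:
  assumes "\<And>f. f \<in> L2 M \<Longrightarrow> A f = A' f"
  shows "singular_value M N A k = singular_value M N A' k"
proof -
  have "is_L2_adjoint M N A = is_L2_adjoint M N A'"
    unfolding is_L2_adjoint_def using assms by (intro ext) auto
  then have adj: "L2_adjoint M N A = L2_adjoint M N A'"
    by (simp add: L2_adjoint_def)
  have "L2_eigenspace M (\<lambda>f. L2_adjoint M N A (A f)) = L2_eigenspace M (\<lambda>f. L2_adjoint M N A' (A' f))"
    unfolding L2_eigenspace_def adj using assms by (intro ext) auto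
  then show ?thesis
    by (simp add: singular_value_def nth_eigenvalue_def is_nth_eigenvalue_def eigenvalue_mult_def)
qed

lemma nth_eigenvalue_eqI: "is_nth_eigenvalue M A k l \<Longrightarrow> nth_eigenvalue M A k = l"
  unfolding nth_eigenvalue_def using is_nth_eigenvalue_unique by blast

lemma eigenvalue_mult_ge:
  assumes "\<And>i. i < n \<Longrightarrow> e i \<in> L2_eigenspace M A l" "L2_independent M n e"
  shows "enat n \<le> eigenvalue_mult M A l"
  unfolding eigenvalue_mult_def by (rule SUP_upper) (use assms in auto)

lemma eigenvalue_mult_le:
  assumes "\<And>m e. (\<And>i. i < m \<Longrightarrow> e i \<in> L2_eigenspace M A l) \<Longrightarrow> L2_independent M m e \<Longrightarrow> m \<le> n"
  shows "eigenvalue_mult M A l \<le> enat n"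
  unfolding eigenvalue_mult_def by (rule SUP_least) (use assms in auto)

text \<open>\<open>inner_one\<close> is the weak form of A* A 1 = 1. \<open>compact\<close> encodes
  strong convergence of the images as weak convergence together with convergence of norms.
  \<open>nontrivial\<close> keeps the set whose supremum is \<open>l2\<close> from being
  empty.\<close>

locale compact_markov_operator = prob_space M for M :: "'a measure" +
  fixes N :: "'b measure" and A :: "('a \<Rightarrow> real) \<Rightarrow> 'b \<Rightarrow> real"
  assumes linear: "\<And>f g a b y. f \<in> L2 M \<Longrightarrow> g \<in> L2 M \<Longrightarrow> y \<in> space N \<Longrightarrow>
        A (\<lambda>x. a * f x + b * g x) y = a * A f y + b * A g y"
    and adjoint_exists: "\<exists>B. is_L2_adjoint M N A B"
    and A_L2: "\<And>f. f \<in> L2 M \<Longrightarrow> A f \<in> L2 N"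
    and contraction: "\<And>f. f \<in> L2 M \<Longrightarrow> L2_inner N (A f) (A f) \<le> L2_inner M f f"
    and inner_one: "\<And>f. f \<in> L2 M \<Longrightarrow> L2_inner N (A f) (A (\<lambda>_. 1)) = L2_inner M f (\<lambda>_. 1)"
    and compact: "\<And>f. (\<And>n. f n \<in> L2 M) \<Longrightarrow> (\<And>n. L2_inner M (f n) (f n) = 1) \<Longrightarrow>
        \<exists>k G. strict_mono (k :: nat \<Rightarrow> nat) \<and> G \<in> L2 N \<and>
          (\<forall>H\<in>L2 N. (\<lambda>n. L2_inner N (A (f (k n))) H) \<longlonglongrightarrow> L2_inner N G H) \<and>
          (\<lambda>n. L2_inner N (A (f (k n))) (A (f (k n)))) \<longlonglongrightarrow> L2_inner N G G"
    and nontrivial: "\<exists>f\<in>L2 M. L2_inner M f (\<lambda>_. 1) = 0 \<and> L2_inner M f f \<noteq> 0"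
begin

abbreviation one :: "'a \<Rightarrow> real" where "one \<equiv> (\<lambda>_. 1)"
abbreviation q :: "('a \<Rightarrow> real) \<Rightarrow> real" where "q f \<equiv> L2_inner N (A f) (A f)"
abbreviation AA :: "('a \<Rightarrow> real) \<Rightarrow> 'a \<Rightarrow> real" where "AA \<equiv> (\<lambda>f. L2_adjoint M N A (A f))"

definition l2 :: real where
  "l2 = Sup {q f | f. f \<in> L2 M \<and> L2_inner M f one = 0 \<and> L2_inner M f f = 1}"

lemma one_L2: "one \<in> L2 M"
  by (rule L2_const) unfold_locales

lemma inner_one_one: "L2_inner M one one = 1"
  by (simp add: L2_inner_def prob_space)

lemma A_inner_lincomb_left:
  assumes "f \<in> L2 M" "g \<in> L2 M" "u \<in> L2 N"
  shows "L2_inner N (A (\<lambda>x. a * f x + b * g x)) u = a * L2_inner N (A f) u + b * L2_inner N (A g) u"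
proof -
  have "L2_inner N (A (\<lambda>x. a * f x + b * g x)) u = L2_inner N (\<lambda>y. a * A f y + b * A g y) u"
    unfolding L2_inner_def using linear[OF assms(1,2)] by (intro Bochner_Integration.integral_cong) auto
  then show ?thesis
    using assms by (simp add: L2_inner_lincomb_left A_L2)
qed

lemma A_inner_scale_left:
  assumes "f \<in> L2 M" "u \<in> L2 N"
  shows "L2_inner N (A (\<lambda>x. a * f x)) u = a * L2_inner N (A f) u"
  using A_inner_lincomb_left[OF assms(1,1,2), of a 0] by simp

lemma q_scale: "f \<in> L2 M \<Longrightarrow> q (\<lambda>x. a * f x) = a\<^sup>2 * q f"
  by (simp add: A_inner_scale_left A_L2 L2_scale L2_inner_commute[of N "A f" "A (\<lambda>x. a * f x)"]
      power2_eq_square)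

lemma q_lincomb:
  assumes "f \<in> L2 M" "g \<in> L2 M"
  shows "q (\<lambda>x. a * f x + b * g x) = a\<^sup>2 * q f + 2 * a * b * L2_inner N (A f) (A g) + b\<^sup>2 * q g"
proof -
  note [simp] = A_inner_lincomb_left[OF assms] A_L2[OF assms(1)] A_L2[OF assms(2)]
    A_L2[OF L2_lincomb[OF assms]]
  show ?thesis
    by (simp add: L2_inner_commute[of N "A f" "A (\<lambda>x. a * f x + b * g x)"]
      L2_inner_commute[of N "A g" "A (\<lambda>x. a * f x + b * g x)"] L2_inner_commute[of N "A g" "A f"]
       power2_eq_square algebra_simps)
qed

section \<open>The Rayleigh quotient on the complement of the constants\<close>

lemma q_le_1: "f \<in> L2 M \<Longrightarrow> L2_inner M f f = 1 \<Longrightarrow> q f \<le> 1"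
  using contraction by metis

lemma bdd_q: "bdd_above {q f | f. f \<in> L2 M \<and> L2_inner M f one = 0 \<and> L2_inner M f f = 1}"
  using q_le_1 by (intro bdd_aboveI[of _ 1]) auto

lemma normalized_nontrivial: "\<exists>f\<in>L2 M. L2_inner M f one = 0 \<and> L2_inner M f f = 1"
proof -
  obtain f where f: "f \<in> L2 M" "L2_inner M f one = 0" "L2_inner M f f \<noteq> 0"
    using nontrivial by auto
  define s where "s = 1 / sqrt (L2_inner M f f)"
  have "s\<^sup>2 * L2_inner M f f = 1"
    using f(3) L2_inner_self_nonneg[of M f] by (simp add: s_def power_divide)
  then have "L2_inner M (\<lambda>x. s * f x) (\<lambda>x. s * f x) = 1"
    by (simp add: L2_inner_scale_left L2_inner_scale_right power2_eq_square)
  with f show ?thesis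
    by (intro bexI[of _ "\<lambda>x. s * f x"]) (auto simp: L2_inner_scale_left L2_scale)
qed

lemma q_le:
  assumes f: "f \<in> L2 M" "L2_inner M f one = 0"
  shows "q f \<le> l2 * L2_inner M f f"
proof (cases "L2_inner M f f = 0")
  case True
  then show ?thesis using contraction[OF f(1)] by simp
next
  case False
  define s where "s = 1 / sqrt (L2_inner M f f)"
  have pos: "L2_inner M f f > 0"
    using False L2_inner_self_nonneg[of M f] by simp
  have s: "s\<^sup>2 * L2_inner M f f = 1"
    using pos by (simp add: s_def power_divide)
  then have "L2_inner M (\<lambda>x. s * f x) (\<lambda>x. s * f x) = 1"
    by (simp add: L2_inner_scale_left L2_inner_scale_right power2_eq_square)
  then have "q (\<lambda>x. s * f x) \<le> l2"
    unfolding l2_def using f by (intro cSup_upper bdd_q) (force simp: L2_inner_scale_left L2_scale)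
  then have "s\<^sup>2 * q f \<le> l2" by (simp add: q_scale f)
  then have "L2_inner M f f * (s\<^sup>2 * q f) \<le> L2_inner M f f * l2"
    using pos by (intro mult_left_mono) auto
  also have "L2_inner M f f * (s\<^sup>2 * q f) = (s\<^sup>2 * L2_inner M f f) * q f"
    by simp
  also have "\<dots> = q f" by (simp add: s)
  finally show ?thesis by (simp only: mult.commute[of l2])
qed

lemma l2_le_1: "l2 \<le> 1"
  unfolding l2_def
proof (rule cSup_least)
  show "{q f | f. f \<in> L2 M \<and> L2_inner M f one = 0 \<and> L2_inner M f f = 1} \<noteq> {}"
    using normalized_nontrivial by (metis (mono_tags, lifting) empty_iff mem_Collect_eq)
next
  fix x assume "x \<in> {q f | f. f \<in> L2 M \<and> L2_inner M f one = 0 \<and> L2_inner M f f = 1}"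
  then obtain f where "x = q f" "f \<in> L2 M" "L2_inner M f f = 1" by blast
  then show "x \<le> 1" using q_le_1 by simp
qed

lemma l2_nonneg: "0 \<le> l2"
proof -
  obtain f where f: "f \<in> L2 M" "L2_inner M f one = 0" "L2_inner M f f = 1"
    using normalized_nontrivial by blast
  have "0 \<le> q f" by (rule L2_inner_self_nonneg)
  also have "\<dots> \<le> l2" using q_le[OF f(1,2)] f(3) by simp
  finally show ?thesis .
qed

text \<open>Completeness of \<open>L\<^sup>2\<close> is not needed: if \<open>A f\<^sub>n\<close> tends to \<open>G\<close> along a maximising sequence, then
  the adjoint image of \<open>G\<close> is a maximiser.\<close>

lemma maximizer_exists:
  "\<exists>u\<in>L2 M. L2_inner M u one = 0 \<and> L2_inner M u u \<noteq> 0 \<and> q u = l2 * L2_inner M u u"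
proof (cases "l2 = 0")
  \<comment> \<open>Treated apart because the limit \<open>G\<close> below would have norm 0 and its
    adjoint image could be null. Here every admissible function is a maximiser.\<close>
  case True
  obtain f where f: "f \<in> L2 M" "L2_inner M f one = 0" "L2_inner M f f \<noteq> 0"
    using nontrivial by blast
  moreover have "q f = 0"
    using q_le[OF f(1,2)] True L2_inner_self_nonneg[of N "A f"] by simp
  ultimately show ?thesis using True by auto
next
  case False
  then have l2: "l2 > 0" using l2_nonneg by simp
  obtain B where B: "is_L2_adjoint M N A B" using adjoint_exists by blast
  have "\<exists>f\<in>L2 M. L2_inner M f one = 0 \<and> L2_inner M f f = 1 \<and> l2 - 1 / real (Suc n) < q f" for n
  proof -
    have "l2 - 1 / real (Suc n) < l2" by simp
    then show ?thesis
      unfolding l2_def using normalized_nontrivial by (subst (asm) less_cSup_iff) (use bdd_q in auto)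
  qed
  then obtain f where f: "\<And>n. f n \<in> L2 M" "\<And>n. L2_inner M (f n) one = 0"
      "\<And>n. L2_inner M (f n) (f n) = 1" "\<And>n. l2 - 1 / real (Suc n) < q (f n)"
    by metis
  have lim: "(\<lambda>n. q (f n)) \<longlonglongrightarrow> l2"
  proof (rule tendsto_sandwich)
    show "\<forall>\<^sub>F n in sequentially. l2 - 1 / real (Suc n) \<le> q (f n)"
      by (intro always_eventually allI less_imp_le f(4))
    show "\<forall>\<^sub>F n in sequentially. q (f n) \<le> l2"
      using q_le[OF f(1,2)] f(3) by auto
    have "(\<lambda>n. 1 / real (Suc n)) \<longlonglongrightarrow> 0"
      using LIMSEQ_inverse_real_of_nat by (simp only: inverse_eq_divide)
    from tendsto_diff[OF tendsto_const[of l2] this] show "(\<lambda>n. l2 - 1 / real (Suc n)) \<longlonglongrightarrow> l2"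
      by (simp only: diff_zero)
  qed simp
  obtain k G where k: "strict_mono k" and G: "G \<in> L2 N"
    and weak': "\<forall>H\<in>L2 N. (\<lambda>n. L2_inner N (A (f (k n))) H) \<longlonglongrightarrow> L2_inner N G H"
    and norm: "(\<lambda>n. q (f (k n))) \<longlonglongrightarrow> L2_inner N G G"
    using compact[of f, OF f(1,3)] by (elim exE conjE) (rule that)
  note weak = bspec[OF weak']
  have GG: "L2_inner N G G = l2"
    using LIMSEQ_unique[OF norm] LIMSEQ_subseq_LIMSEQ[OF lim k] by (simp add: o_def)
  define u where "u = B G"
  have u: "u \<in> L2 M" and adj: "\<And>f. f \<in> L2 M \<Longrightarrow> L2_inner N (A f) G = L2_inner M f u"
    using B G by (auto simp: u_def is_L2_adjoint_def)
  have "(\<lambda>n. L2_inner N (A (f (k n))) (A one)) \<longlonglongrightarrow> L2_inner N G (A one)"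
    by (rule weak) (simp add: A_L2 one_L2)
  then have "L2_inner N G (A one) = 0"
    by (simp add: inner_one f LIMSEQ_const_iff)
  then have u1: "L2_inner M u one = 0"
    using adj[OF one_L2] by (simp add: L2_inner_commute)
  have uu: "L2_inner N (A u) G = L2_inner M u u" by (rule adj[OF u])
  define w where "w = L2_inner M u u"
  \<comment> \<open>The left side is \<open>L2_inner N (A (f (k n))) G\<close>, which tends to the
    squared norm \<open>l2\<close> of \<open>G\<close>. Cauchy-Schwarz thus bounds the norm of
    \<open>u\<close> from below, and \<open>u\<close> is not null.\<close>
  have "L2_inner M (f (k n)) u \<le> sqrt w" for n
    using L2_inner_Cauchy_Schwarz[OF f(1) u, of "k n"] f(3) by (intro real_le_rsqrt) (simp add: w_def)
  moreover have "(\<lambda>n. L2_inner M (f (k n)) u) \<longlonglongrightarrow> l2"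
    using weak[OF G] adj f GG by simp
  ultimately have "l2 \<le> sqrt w"
    by (meson LIMSEQ_le_const2)
  then have "l2\<^sup>2 \<le> (sqrt w)\<^sup>2" and "sqrt w > 0"
    using l2 power_mono[of l2 "sqrt w" 2] by linarith+
  then have lw: "l2\<^sup>2 \<le> w" "w > 0" by (simp_all add: w_def L2_inner_self_nonneg)
  \<comment> \<open>Cauchy-Schwarz for \<open>A u\<close> and \<open>G\<close>, whose inner product
    is \<open>w\<close>. Together with the lower bound on \<open>w\<close> it gives
    \<open>l2 * w \<le> q u\<close>, the converse of \<open>q_le\<close>.\<close>
  have "w\<^sup>2 \<le> q u * l2"
    using L2_inner_Cauchy_Schwarz[OF A_L2[OF u] G] uu GG by (simp add: w_def)
  moreover have "l2\<^sup>2 * w \<le> w\<^sup>2"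
    unfolding power2_eq_square[of w] by (rule mult_right_mono[OF lw(1)]) (use lw(2) in simp)
  ultimately have "l2 * (l2 * w) \<le> l2 * q u"
    by (simp add: power2_eq_square mult.commute mult.left_commute)
  then have "l2 * w \<le> q u"
    using l2 by simp
  with q_le[OF u u1] have "q u = l2 * w" by (simp add: w_def)
  with u u1 lw(2) show ?thesis by (auto simp: w_def)
qed

text \<open>On the complement of the constants \<open>l2 * L2_inner M f f - q f\<close> is
  nonnegative, and it vanishes at \<open>u\<close>, so its first variation there is zero. This is
  the weak eigenvalue equation.\<close>

lemma maximizer_stationary:
  assumes u: "u \<in> L2 M" "L2_inner M u one = 0" "q u = l2 * L2_inner M u u" and v: "v \<in> L2 M"
  shows "L2_inner N (A u) (A v) = l2 * L2_inner M u v"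
proof -
  \<comment> \<open>Only variations orthogonal to the constants are admissible, so the mean of
    \<open>v\<close> is removed. The removed part contributes nothing to either side, by
    \<open>inner_one\<close> and the orthogonality of \<open>u\<close>.\<close>
  define c where "c = L2_inner M v one"
  define w where "w = (\<lambda>x. 1 * v x + (- c) * one x)"
  have w: "w \<in> L2 M" unfolding w_def by (rule L2_lincomb[OF v one_L2])
  have w1: "L2_inner M w one = 0"
    unfolding w_def by (subst L2_inner_lincomb_left[OF v one_L2 one_L2]) (simp add: c_def inner_one_one)
  have "0 \<le> 2 * t * (l2 * L2_inner M u w - L2_inner N (A u) (A w)) + t\<^sup>2 * (l2 * L2_inner M w w - q w)" for t
  proof -
    have "q (\<lambda>x. 1 * u x + t * w x) \<le>
        l2 * L2_inner M (\<lambda>x. 1 * u x + t * w x) (\<lambda>x. 1 * u x + t * w x)"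
      by (rule q_le[OF L2_lincomb[OF u(1) w]])
        (subst L2_inner_lincomb_left[OF u(1) w one_L2], simp add: u w1)
    then show ?thesis
      by (simp only: q_lincomb[OF u(1) w] L2_inner_lincomb_self[OF u(1) w])
        (simp add: u(3) algebra_simps)
  qed
  from linear_coeff_zero[OF this] have "L2_inner N (A u) (A w) = l2 * L2_inner M u w" by simp
  moreover have "L2_inner N (A u) (A w) = L2_inner N (A u) (A v)"
    unfolding w_def using u inner_one[OF u(1)]
    by (subst (1 2) L2_inner_commute, subst A_inner_lincomb_left[OF v one_L2 A_L2[OF u(1)]])
       (simp add: L2_inner_commute)
  moreover have "L2_inner M u w = L2_inner M u v"
    unfolding w_def using u by (subst L2_inner_lincomb_right[OF v one_L2 u(1)]) simp
  ultimately show ?thesis by simp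
qed

section \<open>Eigenspaces and their multiplicities\<close>

lemma adjoint: "is_L2_adjoint M N A (L2_adjoint M N A)"
  by (rule L2_adjoint_is_adjoint[OF adjoint_exists])

lemma AA_L2: "f \<in> L2 M \<Longrightarrow> AA f \<in> L2 M"
  using adjoint A_L2 by (auto simp: is_L2_adjoint_def)

lemma AA_inner: "f \<in> L2 M \<Longrightarrow> g \<in> L2 M \<Longrightarrow> L2_inner M g (AA f) = L2_inner N (A g) (A f)"
  using adjoint A_L2 by (simp add: is_L2_adjoint_def)

text \<open>The adjoint is a choice determined up to null sets; testing against all of
  \<open>L2 M\<close> leaves an equation in \<open>A\<close> alone. Conversely, the residual
  \<open>d\<close> is tested against itself.\<close>

lemma eigenspace_iff:
  "f \<in> L2_eigenspace M AA m \<longleftrightarrow>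
     f \<in> L2 M \<and> (\<forall>g\<in>L2 M. L2_inner N (A f) (A g) = m * L2_inner M f g)"
proof (intro iffI conjI ballI)
  assume f: "f \<in> L2_eigenspace M AA m"
  then show fL: "f \<in> L2 M" by (simp add: L2_eigenspace_def)
  fix g assume g: "g \<in> L2 M"
  have "L2_inner N (A f) (A g) = L2_inner M (AA f) g"
    using AA_inner[OF fL g] by (simp add: L2_inner_commute)
  also have "\<dots> = L2_inner M (\<lambda>x. m * f x) g"
    using f fL g AA_L2[OF fL] L2_scale[OF fL, of m]
    by (intro L2_inner_cong_AE) (auto simp: L2_eigenspace_def)
  finally show "L2_inner N (A f) (A g) = m * L2_inner M f g"
    by (simp add: L2_inner_scale_left)
next
  assume asm: "f \<in> L2 M \<and> (\<forall>g\<in>L2 M. L2_inner N (A f) (A g) = m * L2_inner M f g)"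
  then have f: "f \<in> L2 M" by simp
  define d where "d = (\<lambda>x. 1 * AA f x + (- m) * f x)"
  have d: "d \<in> L2 M" unfolding d_def by (rule L2_lincomb[OF AA_L2[OF f] f])
  have "L2_inner M d d = L2_inner M (AA f) d - m * L2_inner M f d"
    by (subst (1) d_def) (subst L2_inner_lincomb_left[OF AA_L2[OF f] f d], simp)
  also have "L2_inner M (AA f) d = L2_inner N (A f) (A d)"
    using AA_inner[OF f d] by (simp add: L2_inner_commute)
  finally have "L2_inner M d d = 0" using asm d by simp
  then have "AE x in M. d x = 0" using L2_inner_self_eq_0_iff[OF d] by simp
  then show "f \<in> L2_eigenspace M AA m"
    using f by (auto simp: L2_eigenspace_def d_def)
qed

lemma eigenspace_lincomb:
  assumes "f \<in> L2_eigenspace M AA m" "g \<in> L2_eigenspace M AA m"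
  shows "(\<lambda>x. a * f x + b * g x) \<in> L2_eigenspace M AA m"
  using assms
  by (auto simp: eigenspace_iff L2_lincomb A_inner_lincomb_left A_L2 L2_inner_lincomb_left algebra_simps)

text \<open>Otherwise the Rayleigh quotient of \<open>f\<close> would be \<open>m\<close>, above its
  supremum \<open>l2\<close>.\<close>

lemma eigenspace_null:
  assumes "f \<in> L2_eigenspace M AA m" "l2 < m" "L2_inner M f one = 0"
  shows "AE x in M. f x = 0"
proof -
  have f: "f \<in> L2 M" and "q f = m * L2_inner M f f"
    using assms(1) by (auto simp: eigenspace_iff)
  with q_le[OF f assms(3)] have "(m - l2) * L2_inner M f f \<le> 0" by (simp add: algebra_simps)
  then have "L2_inner M f f = 0"
    using assms(2) L2_inner_self_nonneg[of M f] by (simp add: mult_le_0_iff)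
  then show ?thesis using L2_inner_self_eq_0_iff[OF f] by simp
qed

text \<open>Eigenfunctions for different eigenvalues are orthogonal, and the constants belong to the
  eigenvalue 1.\<close>

lemma eigenspace_orth:
  assumes "f \<in> L2_eigenspace M AA m" "m \<noteq> 1"
  shows "L2_inner M f one = 0"
proof -
  have f: "f \<in> L2 M" and "L2_inner N (A f) (A one) = m * L2_inner M f one"
    using assms(1) one_L2 by (auto simp: eigenspace_iff)
  then have "(m - 1) * L2_inner M f one = 0" using inner_one[OF f] by (simp add: algebra_simps)
  with assms(2) show ?thesis by simp
qed

lemma mult_eq_0:
  assumes "l2 < m" "m \<noteq> 1"
  shows "eigenvalue_mult M AA m = 0"
proof -
  have "eigenvalue_mult M AA m \<le> enat 0"
  proof (rule eigenvalue_mult_le)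
    fix n e assume e: "\<And>i. i < n \<Longrightarrow> e i \<in> L2_eigenspace M AA m" "L2_independent M n e"
    show "n \<le> 0"
    proof (rule ccontr)
      assume "\<not> n \<le> 0"
      then have n: "0 < n" by simp
      have "AE x in M. e 0 x = 0"
        using eigenspace_null[OF e(1)[OF n] assms(1) eigenspace_orth[OF e(1)[OF n] assms(2)]] .
      moreover have "(\<Sum>i<n. of_bool (i = 0) * e i x) = e 0 x" for x
        using n by (subst sum.remove[of _ 0]) (auto intro!: sum.neutral)
      ultimately have "AE x in M. (\<Sum>i<n. of_bool (i = 0) * e i x) = 0" by simp
      from mp[OF spec[OF e(2)[unfolded L2_independent_def], of "\<lambda>i. of_bool (i = 0)"] this] n
      show False by auto
    qed
  qed
  then show ?thesis by (simp flip: zero_enat_def)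
qed

text \<open>Any two eigenfunctions have a nontrivial combination orthogonal to the constants, and
  that combination is null by \<open>eigenspace_null\<close>.\<close>

lemma mult_1_le:
  assumes "l2 < 1"
  shows "eigenvalue_mult M AA 1 \<le> 1"
  unfolding one_enat_def
proof (rule eigenvalue_mult_le)
  fix n e assume e: "\<And>i. i < n \<Longrightarrow> e i \<in> L2_eigenspace M AA 1" "L2_independent M n e"
  show "n \<le> 1"
  proof (rule ccontr)
    assume "\<not> n \<le> 1"
    then have n: "0 < n" "1 < n" by auto
    have L: "e 0 \<in> L2 M" "e 1 \<in> L2 M" using e(1) n by (auto simp: eigenspace_iff)
    define a where "a = L2_inner M (e 1) one"
    define b where "b = L2_inner M (e 0) one"
    \<comment> \<open>A nonzero solution of \<open>\<alpha> * b + \<beta> * a = 0\<close>: the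
      vector (a, -b), or (0, 1) if \<open>a = 0\<close>.\<close>
    define \<alpha> where "\<alpha> = (if a = 0 then 0 else a)"
    define \<beta> where "\<beta> = (if a = 0 then 1 else - b)"
    have nz: "\<alpha> \<noteq> 0 \<or> \<beta> \<noteq> 0" by (auto simp: \<alpha>_def \<beta>_def)
    have "\<alpha> * b + \<beta> * a = 0" by (auto simp: \<alpha>_def \<beta>_def)
    then have orth: "L2_inner M (\<lambda>x. \<alpha> * e 0 x + \<beta> * e 1 x) one = 0"
      by (subst L2_inner_lincomb_left[OF L one_L2]) (simp add: a_def b_def)
    have "AE x in M. \<alpha> * e 0 x + \<beta> * e 1 x = 0"
      by (rule eigenspace_null[OF eigenspace_lincomb[OF e(1)[OF n(1)] e(1)[OF n(2)]] assms orth])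
    moreover define c where "c = (\<lambda>i::nat. if i = 0 then \<alpha> else if i = 1 then \<beta> else 0)"
    have "(\<Sum>i<n. c i * e i x) = (\<Sum>i\<in>{0,1}. c i * e i x)" for x
      using n by (intro sum.mono_neutral_right) (auto simp: c_def)
    ultimately have "AE x in M. (\<Sum>i<n. c i * e i x) = 0" by (simp add: c_def)
    then have "c i = 0" if "i < n" for i
      using e(2) that unfolding L2_independent_def by auto
    from this[OF n(1)] this[OF n(2)] nz show False by (simp add: c_def)
  qed
qed

lemma one_eigen: "one \<in> L2_eigenspace M AA 1"
  using one_L2 inner_one by (simp add: eigenspace_iff) (metis L2_inner_commute)

theorem is_second_eigenvalue: "is_nth_eigenvalue M AA 2 l2"
proof -
  obtain u where u: "u \<in> L2 M" "L2_inner M u one = 0" "L2_inner M u u \<noteq> 0" "q u = l2 * L2_inner M u u"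
    using maximizer_exists by auto
  have u_eig: "u \<in> L2_eigenspace M AA l2"
    using maximizer_stationary[OF u(1,2,4)] u(1) by (simp add: eigenspace_iff)
  have null: "c = 0" if "f \<in> L2 M" "L2_inner M f f \<noteq> 0" "AE x in M. c * f x = 0" for c f
    using L2_inner_self_eq_0_iff[OF L2_scale[OF that(1), of c]] that
    by (auto simp: L2_inner_scale_left L2_inner_scale_right)
  let ?m = "eigenvalue_mult M AA"
  have finite_le: "sum ?m F \<le> infsum ?m S" if "finite F" "F \<subseteq> S" for F S
  proof -
    have "infsum ?m F \<le> infsum ?m S"
      by (rule infsum_mono_neutral) (use that in \<open>auto intro: nonneg_summable_on_complete\<close>)
    then show ?thesis using that(1) by simp
  qed
  \<comment> \<open>If \<open>l2 < 1\<close>, the only eigenvalue above \<open>l2\<close> is 1, and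
    it is simple; if \<open>l2 = 1\<close>, there is none.\<close>
  have gt: "infsum ?m {l2<..} < enat 2"
  proof (cases "l2 < 1")
    case True
    have "infsum ?m {l2<..} = infsum ?m {1}"
      by (rule infsum_cong_neutral) (use True mult_eq_0 in auto)
    then have "infsum ?m {l2<..} \<le> 1" using mult_1_le[OF True] by simp
    then show ?thesis by (rule le_less_trans) (simp add: one_enat_def)
  next
    case False
    have "infsum ?m {l2<..} = 0"
      by (rule infsum_0) (use False mult_eq_0 in auto)
    then show ?thesis by (simp add: zero_enat_def)
  qed
  have ge: "enat 2 \<le> infsum ?m {l2..}"
  \<comment> \<open>If \<open>l2 = 1\<close>, both entries come from one eigenspace, so independence
    of \<open>u\<close> and the constants is required. Otherwise \<open>l2\<close> and 1 contribute
    one entry each.\<close>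
  proof (cases "l2 = 1")
    case True
    define e where "e = (\<lambda>i::nat. if i = 0 then one else u)"
    have "L2_independent M 2 e"
      unfolding L2_independent_def
    proof (intro allI impI)
      fix c :: "nat \<Rightarrow> real" and i :: nat
      assume "AE x in M. (\<Sum>i<2. c i * e i x) = 0" "i < 2"
      then have ae: "AE x in M. c 0 * one x + c 1 * u x = 0"
        by (simp add: numeral_2_eq_2 e_def)
      have "L2_inner M (\<lambda>x. c 0 * one x + c 1 * u x) one = L2_inner M (\<lambda>_. 0) one"
        using ae L2_lincomb[OF one_L2 u(1), of "c 0" "c 1"] by (intro L2_inner_cong_AE) auto
      then have "c 0 = 0"
        by (subst (asm) L2_inner_lincomb_left[OF one_L2 u(1) one_L2])
           (simp add: u inner_one_one, simp add: L2_inner_def)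
      with ae have "AE x in M. c 1 * u x = 0" by simp
      then have "c 1 = 0" by (rule null[OF u(1,3)])
      with \<open>c 0 = 0\<close> \<open>i < 2\<close> show "c i = 0" by (auto simp: less_2_cases_iff)
    qed
    then have "enat 2 \<le> ?m 1"
      using one_eigen u_eig True by (intro eigenvalue_mult_ge[of 2 e]) (auto simp: e_def)
    also have "?m 1 = sum ?m {1}" by simp
    also have "\<dots> \<le> infsum ?m {l2..}"
      by (rule finite_le) (use True in auto)
    finally show ?thesis .
  next
    case False
    then have lt: "l2 < 1" using l2_le_1 by simp
    have "L2_independent M 1 (\<lambda>_. u)"
      unfolding L2_independent_def using L2_inner_self_eq_0_iff[OF u(1)] u(3) by auto
    then have m1: "enat 1 \<le> ?m l2"
      using u_eig by (intro eigenvalue_mult_ge[of 1 "\<lambda>_. u"]) auto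
    have "L2_independent M 1 (\<lambda>_. one)"
      unfolding L2_independent_def by auto
    then have m2: "enat 1 \<le> ?m 1"
      using one_eigen by (intro eigenvalue_mult_ge[of 1 "\<lambda>_. one"]) auto
    have "enat 2 = enat 1 + enat 1" by simp
    also have "\<dots> \<le> ?m l2 + ?m 1" by (intro add_mono m1 m2)
    also have "\<dots> = sum ?m {l2, 1}" using lt by simp
    also have "\<dots> \<le> infsum ?m {l2..}"
      by (rule finite_le) (use lt in auto)
    finally show ?thesis .
  qed
  show ?thesis unfolding is_nth_eigenvalue_def using gt ge by simp
qed

lemma singular_value_2: "singular_value M N A 2 = sqrt l2"
  unfolding singular_value_def by (simp add: nth_eigenvalue_eqI[OF is_second_eigenvalue])

lemma singular_value_2_bound:
  assumes f: "f \<in> L2 M" "L2_inner M f one = 0" "L2_inner M f f > 0"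
    and d: "L2_inner M f f - q f \<le> d"
  shows "1 - singular_value M N A 2 \<le> d / L2_inner M f f"
proof -
  have "(1 - l2) * L2_inner M f f \<le> d"
    using q_le[OF f(1,2)] d by (simp add: algebra_simps)
  then have "1 - l2 \<le> d / L2_inner M f f" using f(3) by (simp add: pos_le_divide_eq)
  \<comment> \<open>Since \<open>l2\<close> lies between 0 and 1, passing from eigenvalue to
    singular value only shrinks the gap.\<close>
  moreover have "l2 \<le> sqrt l2"
    using l2_le_1 l2_nonneg by (intro real_le_rsqrt) (simp add: power2_eq_square mult_left_le)
  ultimately show ?thesis by (simp add: singular_value_2)
qed

end

section \<open>Operators given by bounded Markov kernels\<close>

text \<open>Jensen's inequality for an unnormalised weight, obtained by splitting \<open>w\<close>
  into two square roots. No division occurs, so the total weight may be zero.\<close>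

lemma weighted_Cauchy_Schwarz:
  fixes w f :: "'a \<Rightarrow> real"
  assumes w: "integrable M w" "\<And>x. 0 \<le> w x"
    and f: "f \<in> borel_measurable M" and wf: "integrable M (\<lambda>x. w x * (f x)\<^sup>2)"
  shows "(\<integral>x. w x * f x \<partial>M)\<^sup>2 \<le> (\<integral>x. w x \<partial>M) * (\<integral>x. w x * (f x)\<^sup>2 \<partial>M)"
proof -
  have [measurable]: "w \<in> borel_measurable M" "f \<in> borel_measurable M" using w f by auto
  have a: "(\<lambda>x. sqrt (w x)) \<in> L2 M" using w by (simp add: L2_def)
  have b: "(\<lambda>x. sqrt (w x) * f x) \<in> L2 M" using wf w by (simp add: L2_def power_mult_distrib)
  have eq: "sqrt (w x) * sqrt (w x) = w x" for x using w(2)[of x] by simp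
  have "L2_inner M (\<lambda>x. sqrt (w x)) (\<lambda>x. sqrt (w x) * f x) = (\<integral>x. w x * f x \<partial>M)"
    unfolding L2_inner_def by (simp only: mult.assoc[symmetric] eq)
  moreover have "L2_inner M (\<lambda>x. sqrt (w x)) (\<lambda>x. sqrt (w x)) = (\<integral>x. w x \<partial>M)"
    unfolding L2_inner_def by (simp only: eq)
  moreover have "L2_inner M (\<lambda>x. sqrt (w x) * f x) (\<lambda>x. sqrt (w x) * f x) = (\<integral>x. w x * (f x)\<^sup>2 \<partial>M)"
    unfolding L2_inner_def
    by (intro Bochner_Integration.integral_cong refl)
       (metis (no_types, lifting) eq mult.assoc mult.left_commute power2_eq_square)
  ultimately show ?thesis using L2_inner_Cauchy_Schwarz[OF a b] by simp
qed

text \<open>\<open>k\<close> is a transition density relative to \<open>N\<close> for a start point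
  with law \<open>M\<close>. Its boundedness supplies integrability and the majorants for dominated
  convergence.\<close>

locale bounded_markov_kernel = M: prob_space M + N: finite_measure N
  for M :: "'a measure" and N :: "'b measure" +
  fixes k :: "'a \<Rightarrow> 'b \<Rightarrow> real" and c :: real
  assumes k_meas [measurable]: "case_prod k \<in> borel_measurable (M \<Otimes>\<^sub>M N)"
    and k_nonneg: "\<And>x y. 0 \<le> k x y"
    and k_le: "\<And>x y. k x y \<le> c"
    and k_int: "\<And>x. x \<in> space M \<Longrightarrow> (\<integral>y. k x y \<partial>N) = 1"
begin

text \<open>Under the joint law with density \<open>k\<close>, \<open>hn\<close> is the density of
  the end point, \<open>A f\<close> the conditional expectation of \<open>f\<close> at the start
  given the end, and \<open>B g\<close> that of \<open>g\<close> at the end given the start.\<close>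

definition hn :: "'b \<Rightarrow> real" where "hn y = (\<integral>x. k x y \<partial>M)"
definition nuN :: "'b measure" where "nuN = density N (\<lambda>y. ennreal (hn y))"
definition A :: "('a \<Rightarrow> real) \<Rightarrow> 'b \<Rightarrow> real" where "A f y = 1 / hn y * (\<integral>x. k x y * f x \<partial>M)"
definition B :: "('b \<Rightarrow> real) \<Rightarrow> 'a \<Rightarrow> real" where "B g x = (\<integral>y. k x y * g y \<partial>N)"

sublocale P: pair_sigma_finite M N ..
sublocale Q: pair_sigma_finite N M ..

lemma k_meas_swap [measurable]: "(\<lambda>(y, x). k x y) \<in> borel_measurable (N \<Otimes>\<^sub>M M)"
  using measurable_pair_swap[OF k_meas] by (simp add: case_prod_beta')

lemma k_meas_fst [measurable]: "y \<in> space N \<Longrightarrow> (\<lambda>x. k x y) \<in> borel_measurable M"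
  using measurable_compose[OF measurable_Pair2' k_meas] by simp

lemma k_meas_snd [measurable]: "x \<in> space M \<Longrightarrow> k x \<in> borel_measurable N"
  using measurable_compose[OF measurable_Pair1' k_meas] by simp

lemma c_nonneg: "0 \<le> c"
  using k_nonneg k_le order_trans by blast

lemma k_integrable_mult:
  assumes "y \<in> space N" "integrable M f"
  shows "integrable M (\<lambda>x. k x y * f x)"
proof (rule Bochner_Integration.integrable_bound)
  show "integrable M (\<lambda>x. c * f x)" using assms by simp
  show "(\<lambda>x. k x y * f x) \<in> borel_measurable M" using assms by measurable
  show "AE x in M. norm (k x y * f x) \<le> norm (c * f x)"
    using k_nonneg k_le c_nonneg by (auto simp: abs_mult intro!: mult_right_mono)
qed

lemma k_integrable_fst: "y \<in> space N \<Longrightarrow> integrable M (\<lambda>x. k x y)"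
  using k_integrable_mult[of y "\<lambda>_. 1"] by simp

lemma k_integrable_snd: "x \<in> space M \<Longrightarrow> integrable N (k x)"
  by (rule N.integrable_const_bound[where B = c]) (use k_nonneg k_le in auto)

lemma hn_nonneg: "0 \<le> hn y"
  by (simp add: hn_def k_nonneg)

lemma hn_meas [measurable]: "hn \<in> borel_measurable N"
  unfolding hn_def[abs_def] by measurable

lemma measurable_nuN [simp]: "measurable nuN K = measurable N K"
  by (simp add: nuN_def measurable_def)

lemma L2_nuN_iff: "g \<in> L2 nuN \<longleftrightarrow> g \<in> borel_measurable N \<and> integrable N (\<lambda>y. hn y * (g y)\<^sup>2)"
  unfolding L2_def by (auto simp: nuN_def hn_nonneg integrable_real_density)

lemma hn_le:
  assumes "y \<in> space N"
  shows "hn y \<le> c"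
proof -
  have "hn y \<le> (\<integral>x. c \<partial>M)"
    unfolding hn_def using k_le k_integrable_fst[OF assms] by (intro integral_mono) auto
  then show ?thesis by (simp add: M.prob_space)
qed

lemma L2_nuN_bounded:
  assumes [measurable]: "g \<in> borel_measurable N" and C: "\<And>y. y \<in> space N \<Longrightarrow> \<bar>g y\<bar> \<le> C"
  shows "g \<in> L2 nuN"
  unfolding L2_nuN_iff
proof (intro conjI N.integrable_const_bound[where B = "c * C\<^sup>2"] AE_I2)
  fix y assume y: "y \<in> space N"
  have "(g y)\<^sup>2 \<le> C\<^sup>2" using power_mono[OF C[OF y], of 2] by simp
  then show "norm (hn y * (g y)\<^sup>2) \<le> c * C\<^sup>2"
    using hn_le[OF y] hn_nonneg c_nonneg by (simp add: mult_mono)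
qed measurable

lemma inner_nuN:
  assumes [measurable]: "f \<in> borel_measurable N" "g \<in> borel_measurable N"
  shows "L2_inner nuN f g = (\<integral>y. hn y * (f y * g y) \<partial>N)"
  unfolding L2_inner_def nuN_def by (subst integral_real_density) (auto simp: hn_nonneg)

section \<open>The joint law of start and end point\<close>

lemma pair_integrable_fst:
  assumes f: "integrable M f"
  shows "integrable (M \<Otimes>\<^sub>M N) (\<lambda>(x, y). k x y * f x)"
proof (rule P.Fubini_integrable)
  have [measurable]: "f \<in> borel_measurable M" using f by auto
  show "(\<lambda>(x, y). k x y * f x) \<in> borel_measurable (M \<Otimes>\<^sub>M N)" by measurable
  have "(\<integral>y. norm (k x y * f x) \<partial>N) = \<bar>f x\<bar>" if "x \<in> space M" for x
    using k_int[OF that] k_integrable_snd[OF that] k_nonneg by (simp add: abs_mult)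
  then show "integrable M (\<lambda>x. \<integral>y. norm (case (x, y) of (x, y) \<Rightarrow> k x y * f x) \<partial>N)"
    using f by (subst Bochner_Integration.integrable_cong[OF refl, of _ _ "\<lambda>x. \<bar>f x\<bar>"]) auto
  show "AE x in M. integrable N (\<lambda>y. case (x, y) of (x, y) \<Rightarrow> k x y * f x)"
    using k_integrable_snd by (auto intro!: AE_I2)
qed

lemma pair_integrable_snd:
  assumes g: "g \<in> borel_measurable N" "integrable N (\<lambda>y. hn y * g y)"
  shows "integrable (M \<Otimes>\<^sub>M N) (\<lambda>(x, y). k x y * g y)"
proof -
  note [measurable] = g(1)
  have "integrable (N \<Otimes>\<^sub>M M) (\<lambda>(y, x). k x y * g y)"
  proof (rule Q.Fubini_integrable)
    show "(\<lambda>(y, x). k x y * g y) \<in> borel_measurable (N \<Otimes>\<^sub>M M)" by measurable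
    have "(\<integral>x. norm (k x y * g y) \<partial>M) = \<bar>hn y * g y\<bar>" if "y \<in> space N" for y
      using k_integrable_fst[OF that] k_nonneg hn_nonneg by (simp add: abs_mult) (simp add: hn_def)
    then show "integrable N (\<lambda>y. \<integral>x. norm (case (y, x) of (y, x) \<Rightarrow> k x y * g y) \<partial>M)"
      using g(2) by (subst Bochner_Integration.integrable_cong[OF refl, of _ _ "\<lambda>y. \<bar>hn y * g y\<bar>"]) auto
    show "AE y in N. integrable M (\<lambda>x. case (y, x) of (y, x) \<Rightarrow> k x y * g y)"
      using k_integrable_fst by (auto intro!: AE_I2)
  qed
  from Q.integrable_product_swap[OF this] show ?thesis by simp
qed

lemma pair_integral_fst:
  assumes f: "integrable M f"
  shows "(\<integral>(x, y). k x y * f x \<partial>(M \<Otimes>\<^sub>M N)) = (\<integral>x. f x \<partial>M)"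
proof -
  have "(\<integral>(x, y). k x y * f x \<partial>(M \<Otimes>\<^sub>M N)) = (\<integral>x. (\<integral>y. k x y * f x \<partial>N) \<partial>M)"
    using P.integral_fst'[OF pair_integrable_fst[OF f]] by simp
  also have "\<dots> = (\<integral>x. f x \<partial>M)"
    using k_int k_integrable_snd by (intro Bochner_Integration.integral_cong) auto
  finally show ?thesis .
qed

lemma pair_integral_snd:
  assumes g: "g \<in> borel_measurable N" "integrable N (\<lambda>y. hn y * g y)"
  shows "(\<integral>(x, y). k x y * g y \<partial>(M \<Otimes>\<^sub>M N)) = (\<integral>y. hn y * g y \<partial>N)"
proof -
  have "(\<integral>(x, y). k x y * g y \<partial>(M \<Otimes>\<^sub>M N)) = (\<integral>y. (\<integral>x. k x y * g y \<partial>M) \<partial>N)"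
    using P.integral_snd[of "\<lambda>x y. k x y * g y"] pair_integrable_snd[OF g] by simp
  also have "\<dots> = (\<integral>y. hn y * g y \<partial>N)"
    using k_integrable_fst by (intro Bochner_Integration.integral_cong) (auto simp: hn_def)
  finally show ?thesis .
qed

lemma L2_integrable: "f \<in> L2 M \<Longrightarrow> integrable M f"
  using L2_mult_integrable[OF _ L2_const[OF M.finite_measure_axioms, of 1]] by simp

lemma pair_integrable_mult:
  assumes f: "f \<in> L2 M" and g: "g \<in> L2 nuN"
  shows "integrable (M \<Otimes>\<^sub>M N) (\<lambda>(x, y). k x y * (f x * g y))"
proof (rule Bochner_Integration.integrable_bound)
  have [measurable]: "f \<in> borel_measurable M" "g \<in> borel_measurable N"
    using f g by (auto simp: L2_nuN_iff)
  show "integrable (M \<Otimes>\<^sub>M N) (\<lambda>z. (case z of (x, y) \<Rightarrow> k x y * (f x)\<^sup>2) + (case z of (x, y) \<Rightarrow> k x y * (g y)\<^sup>2))"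
    using f g by (intro Bochner_Integration.integrable_add pair_integrable_fst pair_integrable_snd)
      (auto simp: L2_nuN_iff)
  show "(\<lambda>(x, y). k x y * (f x * g y)) \<in> borel_measurable (M \<Otimes>\<^sub>M N)" by measurable
  have "\<bar>k x y * (f x * g y)\<bar> \<le> k x y * ((f x)\<^sup>2 + (g y)\<^sup>2)" for x y
    unfolding abs_mult[of "k x y"] using k_nonneg[of x y] abs_mult_le_sum_squares[of "f x" "g y"]
    by (simp add: mult_left_mono)
  then show "AE z in M \<Otimes>\<^sub>M N. norm (case z of (x, y) \<Rightarrow> k x y * (f x * g y)) \<le>
      norm ((case z of (x, y) \<Rightarrow> k x y * (f x)\<^sup>2) + (case z of (x, y) \<Rightarrow> k x y * (g y)\<^sup>2))"
    using k_nonneg by (auto simp: distrib_left)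
qed

section \<open>Conditional expectation: contraction, adjoint, constants\<close>

lemma A_square_le:
  assumes f: "f \<in> L2 M" and y: "y \<in> space N"
  shows "(\<integral>x. k x y * f x \<partial>M)\<^sup>2 \<le> hn y * (\<integral>x. k x y * (f x)\<^sup>2 \<partial>M)"
  unfolding hn_def
  by (rule weighted_Cauchy_Schwarz) (use f y k_integrable_fst k_nonneg k_integrable_mult in auto)

text \<open>Where \<open>hn y = 0\<close>, division by zero makes the left side 0, and
  \<open>A_square_le\<close> forces the integral to vanish as well. The identity therefore has no
  exceptional points.\<close>

lemma hn_A:
  assumes f: "f \<in> L2 M" and y: "y \<in> space N"
  shows "hn y * A f y = (\<integral>x. k x y * f x \<partial>M)"
  using A_square_le[OF assms] by (cases "hn y = 0") (auto simp: A_def)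

text \<open>Conditional Jensen inequality, multiplied by the end-point density.\<close>

lemma hn_A_square_le:
  assumes f: "f \<in> L2 M" and y: "y \<in> space N"
  shows "hn y * (A f y)\<^sup>2 \<le> (\<integral>x. k x y * (f x)\<^sup>2 \<partial>M)"
proof (cases "hn y = 0")
  case True
  then show ?thesis using k_nonneg by simp
next
  case False
  then have "hn y > 0" using hn_nonneg[of y] by simp
  moreover have "hn y * (hn y * (A f y)\<^sup>2) = (hn y * A f y)\<^sup>2"
    by (simp add: power2_eq_square ac_simps)
  then have "hn y * (hn y * (A f y)\<^sup>2) \<le> hn y * (\<integral>x. k x y * (f x)\<^sup>2 \<partial>M)"
    using A_square_le[OF assms] hn_A[OF assms] by simp
  ultimately show ?thesis by simp
qed

lemma hn_A_square_le_const:
  assumes f: "f \<in> L2 M" and y: "y \<in> space N"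
  shows "hn y * (A f y)\<^sup>2 \<le> c * L2_inner M f f"
proof -
  have "(\<integral>x. k x y * (f x)\<^sup>2 \<partial>M) \<le> (\<integral>x. c * (f x)\<^sup>2 \<partial>M)"
    using f y k_le by (intro integral_mono k_integrable_mult) (auto intro!: mult_right_mono)
  then show ?thesis
    using hn_A_square_le[OF assms] by (simp add: L2_inner_def power2_eq_square)
qed

lemma A_meas [measurable]:
  assumes [measurable]: "f \<in> borel_measurable M"
  shows "A f \<in> borel_measurable N"
  unfolding A_def[abs_def] by measurable

lemma A_L2_and_contraction:
  assumes f: "f \<in> L2 M"
  shows "A f \<in> L2 nuN" "L2_inner nuN (A f) (A f) \<le> L2_inner M f f"
proof -
  have [measurable]: "f \<in> borel_measurable M" using f by auto
  have int: "integrable (M \<Otimes>\<^sub>M N) (\<lambda>(x, y). k x y * (f x)\<^sup>2)"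
    using f by (intro pair_integrable_fst) auto
  have int_y: "integrable N (\<lambda>y. \<integral>x. k x y * (f x)\<^sup>2 \<partial>M)"
    using P.integrable_snd[OF int] by simp
  have int_A: "integrable N (\<lambda>y. hn y * (A f y)\<^sup>2)"
  proof (rule Bochner_Integration.integrable_bound[OF int_y])
    show "AE y in N. norm (hn y * (A f y)\<^sup>2) \<le> norm (\<integral>x. k x y * (f x)\<^sup>2 \<partial>M)"
      using hn_A_square_le[OF f] hn_nonneg k_nonneg by (intro AE_I2) auto
  qed measurable
  then show "A f \<in> L2 nuN" by (simp add: L2_nuN_iff)
  have "L2_inner nuN (A f) (A f) = (\<integral>y. hn y * (A f y)\<^sup>2 \<partial>N)"
    by (simp add: inner_nuN power2_eq_square)
  also have "\<dots> \<le> (\<integral>y. (\<integral>x. k x y * (f x)\<^sup>2 \<partial>M) \<partial>N)"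
    using hn_A_square_le[OF f] by (intro integral_mono int_A int_y)
  also have "\<dots> = (\<integral>(x, y). k x y * (f x)\<^sup>2 \<partial>(M \<Otimes>\<^sub>M N))"
    using P.integral_snd[OF int] by simp
  also have "\<dots> = L2_inner M f f"
    using pair_integral_fst[of "\<lambda>x. (f x)\<^sup>2"] f by (auto simp: L2_inner_def power2_eq_square)
  finally show "L2_inner nuN (A f) (A f) \<le> L2_inner M f f" .
qed

text \<open>Tower property: both this inner product and the one in \<open>inner_B\<close> are the
  expectation of \<open>f x * g y\<close> under the joint law, which makes \<open>B\<close> an
  adjoint of \<open>A\<close>.\<close>

lemma inner_A:
  assumes f: "f \<in> L2 M" and g: "g \<in> L2 nuN"
  shows "L2_inner nuN (A f) g = (\<integral>(x, y). k x y * (f x * g y) \<partial>(M \<Otimes>\<^sub>M N))"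
proof -
  have [measurable]: "f \<in> borel_measurable M" "g \<in> borel_measurable N"
    using f g by (auto simp: L2_nuN_iff)
  have "L2_inner nuN (A f) g = (\<integral>y. hn y * A f y * g y \<partial>N)"
    by (simp add: inner_nuN mult.assoc)
  also have "\<dots> = (\<integral>y. (\<integral>x. k x y * (f x * g y) \<partial>M) \<partial>N)"
    using hn_A[OF f] by (intro Bochner_Integration.integral_cong) (simp_all flip: mult.assoc)
  also have "\<dots> = (\<integral>(x, y). k x y * (f x * g y) \<partial>(M \<Otimes>\<^sub>M N))"
    using P.integral_snd[OF pair_integrable_mult[OF f g]] by simp
  finally show ?thesis .
qed

lemma inner_B:
  assumes f: "f \<in> L2 M" and g: "g \<in> L2 nuN"
  shows "L2_inner M f (B g) = (\<integral>(x, y). k x y * (f x * g y) \<partial>(M \<Otimes>\<^sub>M N))"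
proof -
  have "L2_inner M f (B g) = (\<integral>x. (\<integral>y. k x y * (f x * g y) \<partial>N) \<partial>M)"
    unfolding L2_inner_def B_def by (simp add: mult.left_commute)
  also have "\<dots> = (\<integral>(x, y). k x y * (f x * g y) \<partial>(M \<Otimes>\<^sub>M N))"
    using P.integral_fst[OF pair_integrable_mult[OF f g]] by simp
  finally show ?thesis .
qed

lemma B_L2:
  assumes g: "g \<in> L2 nuN"
  shows "B g \<in> L2 M"
proof -
  have [measurable]: "g \<in> borel_measurable N" using g by (auto simp: L2_nuN_iff)
  have int: "integrable (M \<Otimes>\<^sub>M N) (\<lambda>(x, y). k x y * (g y)\<^sup>2)"
    using g by (intro pair_integrable_snd) (auto simp: L2_nuN_iff)
  have [measurable]: "B g \<in> borel_measurable M"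
    unfolding B_def[abs_def] by measurable
  have "integrable M (\<lambda>x. (B g x)\<^sup>2)"
  proof (rule Bochner_Integration.integrable_bound)
    show "integrable M (\<lambda>x. \<integral>y. k x y * (g y)\<^sup>2 \<partial>N)"
      using P.integrable_fst[OF int] by simp
    show "AE x in M. norm ((B g x)\<^sup>2) \<le> norm (\<integral>y. k x y * (g y)\<^sup>2 \<partial>N)"
      \<comment> \<open>Fubini gives integrability of the weighted square in \<open>y\<close> for
        almost every \<open>x\<close> only.\<close>
      using P.AE_integrable_fst'[OF int] AE_space
    proof eventually_elim
      case (elim x)
      then have "(B g x)\<^sup>2 \<le> (\<integral>y. k x y \<partial>N) * (\<integral>y. k x y * (g y)\<^sup>2 \<partial>N)"
        unfolding B_def by (intro weighted_Cauchy_Schwarz) (auto simp: k_nonneg k_integrable_snd)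
      then show ?case using k_int[OF elim(2)] k_nonneg by simp
    qed
  qed measurable
  then show ?thesis by (simp add: L2_def)
qed

lemma is_adjoint: "is_L2_adjoint M nuN A B"
  unfolding is_L2_adjoint_def using B_L2 inner_A inner_B by simp

lemma A_linear:
  assumes "f \<in> L2 M" "g \<in> L2 M" "y \<in> space N"
  shows "A (\<lambda>x. a * f x + b * g x) y = a * A f y + b * A g y"
proof -
  have "(\<integral>x. k x y * (a * f x + b * g x) \<partial>M) = (\<integral>x. a * (k x y * f x) + b * (k x y * g x) \<partial>M)"
    by (simp add: algebra_simps)
  also have "\<dots> = a * (\<integral>x. k x y * f x \<partial>M) + b * (\<integral>x. k x y * g x \<partial>M)"
    using k_integrable_mult[OF assms(3) L2_integrable] assms by simp
  finally show ?thesis by (simp add: A_def algebra_simps)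
qed

lemma A_inner_one:
  assumes f: "f \<in> L2 M"
  shows "L2_inner nuN (A f) (A (\<lambda>_. 1)) = L2_inner M f (\<lambda>_. 1)"
proof -
  have 1: "(\<lambda>_. 1) \<in> L2 M" by (rule L2_const) unfold_locales
  have [measurable]: "f \<in> borel_measurable M" using f by auto
  have int: "integrable (M \<Otimes>\<^sub>M N) (\<lambda>(x, y). k x y * f x)"
    using f L2_integrable by (intro pair_integrable_fst) auto
  have "L2_inner nuN (A f) (A (\<lambda>_. 1)) = (\<integral>y. hn y * (A f y * A (\<lambda>_. 1) y) \<partial>N)"
    by (simp add: inner_nuN)
  also have "\<dots> = (\<integral>y. (\<integral>x. k x y * f x \<partial>M) \<partial>N)"
  proof (intro Bochner_Integration.integral_cong refl)
    fix y assume y: "y \<in> space N"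
    \<comment> \<open>The default value 0 at points with \<open>hn y = 0\<close> does no harm, as
      the factor \<open>hn y * A f y\<close> is 0 there too.\<close>
    have "A (\<lambda>_. 1) y = (if hn y = 0 then 0 else 1)" by (simp add: A_def hn_def)
    then show "hn y * (A f y * A (\<lambda>_. 1) y) = (\<integral>x. k x y * f x \<partial>M)"
      using hn_A[OF f y] by auto
  qed
  also have "\<dots> = (\<integral>x. f x \<partial>M)"
    using P.integral_snd[OF int] pair_integral_fst[OF L2_integrable[OF f]] by simp
  finally show ?thesis by (simp add: L2_inner_def)
qed

text \<open>The bound \<open>hn * (A f)\<^sup>2 \<le> c * \<parallel>f\<parallel>\<^sup>2\<close> dominates, so pointwise convergence suffices.\<close>

lemma pointwise_imp_L2_convergent:
  assumes f: "\<And>n. f n \<in> L2 M" "\<And>n. L2_inner M (f n) (f n) \<le> 1"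
    and conv: "\<And>y. y \<in> space N \<Longrightarrow> convergent (\<lambda>n. \<integral>x. k x y * f n x \<partial>M)"
  shows "\<exists>G\<in>L2 nuN. (\<forall>H\<in>L2 nuN. (\<lambda>n. L2_inner nuN (A (f n)) H) \<longlonglongrightarrow> L2_inner nuN G H) \<and>
    (\<lambda>n. L2_inner nuN (A (f n)) (A (f n))) \<longlonglongrightarrow> L2_inner nuN G G"
proof -
  have [measurable]: "f n \<in> borel_measurable M" for n using f by auto
  define G where "G y = lim (\<lambda>n. A (f n) y)" for y
  have lim: "(\<lambda>n. A (f n) y) \<longlonglongrightarrow> G y" if "y \<in> space N" for y
  proof -
    from conv[OF that] have "convergent (\<lambda>n. A (f n) y)"
      unfolding A_def by (rule convergent_mult[OF convergent_const])
    then show ?thesis by (simp add: G_def convergent_LIMSEQ_iff)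
  qed
  have G[measurable]: "G \<in> borel_measurable N"
    by (rule borel_measurable_LIMSEQ_real[OF lim]) auto
  have bound: "hn y * (A (f n) y)\<^sup>2 \<le> c" if "y \<in> space N" for n y
    using hn_A_square_le_const[OF f(1) that, of n] f(2)[of n] c_nonneg
    by (meson mult_left_le order_trans)
  have lim2: "(\<lambda>n. hn y * (A (f n) y)\<^sup>2) \<longlonglongrightarrow> hn y * (G y)\<^sup>2" if "y \<in> space N" for y
    by (intro tendsto_intros lim that)
  have "hn y * (G y)\<^sup>2 \<le> c" if "y \<in> space N" for y
    using lim2[OF that] bound[OF that] by (meson LIMSEQ_le_const2)
  then have G_L2: "G \<in> L2 nuN"
    unfolding L2_nuN_iff using hn_nonneg
    by (auto intro!: N.integrable_const_bound[where B = c] AE_I2)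
  have "(\<lambda>n. L2_inner nuN (A (f n)) H) \<longlonglongrightarrow> L2_inner nuN G H" if H: "H \<in> L2 nuN" for H
  proof -
    have [measurable]: "H \<in> borel_measurable N" using H by (simp add: L2_nuN_iff)
    have "(\<lambda>n. \<integral>y. hn y * (A (f n) y * H y) \<partial>N) \<longlonglongrightarrow> (\<integral>y. hn y * (G y * H y) \<partial>N)"
    proof (rule integral_dominated_convergence)
      show "integrable N (\<lambda>y. c + hn y * (H y)\<^sup>2)" using H by (simp add: L2_nuN_iff)
      show "AE y in N. (\<lambda>n. hn y * (A (f n) y * H y)) \<longlonglongrightarrow> hn y * (G y * H y)"
        by (intro AE_I2 tendsto_intros lim)
      show "AE y in N. norm (hn y * (A (f n) y * H y)) \<le> c + hn y * (H y)\<^sup>2" for n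
      proof (rule AE_I2)
        fix y assume y: "y \<in> space N"
        have "norm (hn y * (A (f n) y * H y)) \<le> hn y * ((A (f n) y)\<^sup>2 + (H y)\<^sup>2)"
          using mult_left_mono[OF abs_mult_le_sum_squares hn_nonneg] hn_nonneg[of y] by (simp add: abs_mult)
        also have "\<dots> \<le> c + hn y * (H y)\<^sup>2" using bound[OF y] by (simp add: distrib_left)
        finally show "norm (hn y * (A (f n) y * H y)) \<le> c + hn y * (H y)\<^sup>2" .
      qed
    qed measurable
    then show ?thesis by (simp add: inner_nuN)
  qed
  moreover have "(\<lambda>n. \<integral>y. hn y * (A (f n) y)\<^sup>2 \<partial>N) \<longlonglongrightarrow> (\<integral>y. hn y * (G y)\<^sup>2 \<partial>N)"
  proof (rule integral_dominated_convergence)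
    show "integrable N (\<lambda>_. c)" by simp
    show "AE y in N. (\<lambda>n. hn y * (A (f n) y)\<^sup>2) \<longlonglongrightarrow> hn y * (G y)\<^sup>2" using lim2 by (rule AE_I2)
    show "AE y in N. norm (hn y * (A (f n) y)\<^sup>2) \<le> c" for n
      using bound hn_nonneg by (intro AE_I2) auto
  qed measurable
  then have "(\<lambda>n. L2_inner nuN (A (f n)) (A (f n))) \<longlonglongrightarrow> L2_inner nuN G G"
    by (simp add: inner_nuN power2_eq_square)
  ultimately show ?thesis using G_L2 by auto
qed

text \<open>Pythagoras for the best predictor: the mean of \<open>(f x - g y)\<^sup>2\<close> under
  the joint law exceeds the left side by the squared norm of \<open>A f - g\<close>. That law has
  mass 1 and charges only pairs with \<open>k x y \<noteq> 0\<close>, whence the bound by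
  \<open>d\<^sup>2\<close>.\<close>

lemma energy_le:
  assumes f: "f \<in> L2 M" and g: "g \<in> L2 nuN"
    and d: "\<And>x y. x \<in> space M \<Longrightarrow> y \<in> space N \<Longrightarrow> k x y \<noteq> 0 \<Longrightarrow> \<bar>f x - g y\<bar> \<le> d"
  shows "L2_inner M f f - L2_inner nuN (A f) (A f) \<le> d\<^sup>2"
proof -
  have [measurable]: "g \<in> borel_measurable N" using g by (simp add: L2_nuN_iff)
  have int1: "integrable (M \<Otimes>\<^sub>M N) (\<lambda>(x, y). k x y * (f x)\<^sup>2)"
    using f by (intro pair_integrable_fst) auto
  have int2: "integrable (M \<Otimes>\<^sub>M N) (\<lambda>(x, y). k x y * (g y)\<^sup>2)"
    using g by (intro pair_integrable_snd) (auto simp: L2_nuN_iff)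
  note int3 = pair_integrable_mult[OF f g]
  have intd: "integrable (M \<Otimes>\<^sub>M N) (\<lambda>(x, y). k x y * d\<^sup>2)"
    by (rule pair_integrable_fst) simp
  have eq: "(\<lambda>(x, y). k x y * (f x - g y)\<^sup>2) = (\<lambda>z. (case z of (x, y) \<Rightarrow> k x y * (f x)\<^sup>2)
      - 2 * (case z of (x, y) \<Rightarrow> k x y * (f x * g y)) + (case z of (x, y) \<Rightarrow> k x y * (g y)\<^sup>2))"
    by (auto simp: fun_eq_iff power2_eq_square algebra_simps)
  have int: "integrable (M \<Otimes>\<^sub>M N) (\<lambda>(x, y). k x y * (f x - g y)\<^sup>2)"
    unfolding eq using int1 int2 int3 by auto
  have "L2_inner M f f - 2 * L2_inner nuN (A f) g + L2_inner nuN g g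
      = (\<integral>(x, y). k x y * (f x)\<^sup>2 \<partial>(M \<Otimes>\<^sub>M N)) - 2 * (\<integral>(x, y). k x y * (f x * g y) \<partial>(M \<Otimes>\<^sub>M N))
        + (\<integral>(x, y). k x y * (g y)\<^sup>2 \<partial>(M \<Otimes>\<^sub>M N))"
  proof -
    have "L2_inner M f f = (\<integral>(x, y). k x y * (f x)\<^sup>2 \<partial>(M \<Otimes>\<^sub>M N))"
      using pair_integral_fst[OF L2D(2)[OF f]] by (simp add: L2_inner_def power2_eq_square)
    moreover have "L2_inner nuN g g = (\<integral>(x, y). k x y * (g y)\<^sup>2 \<partial>(M \<Otimes>\<^sub>M N))"
      using pair_integral_snd[of "\<lambda>y. (g y)\<^sup>2"] g
      by (simp add: inner_nuN L2_nuN_iff power2_eq_square)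
    ultimately show ?thesis by (simp add: inner_A[OF f g])
  qed
  also have "\<dots> = (\<integral>(x, y). k x y * (f x - g y)\<^sup>2 \<partial>(M \<Otimes>\<^sub>M N))"
    unfolding eq using int1 int2 int3 by simp
  also have "\<dots> \<le> (\<integral>(x, y). k x y * d\<^sup>2 \<partial>(M \<Otimes>\<^sub>M N))"
  proof (rule integral_mono[OF int intd])
    fix z assume z: "z \<in> space (M \<Otimes>\<^sub>M N)"
    obtain x y where xy: "z = (x, y)" "x \<in> space M" "y \<in> space N"
      using z by (auto simp: space_pair_measure)
    have "k x y * (f x - g y)\<^sup>2 \<le> k x y * d\<^sup>2"
    proof (cases "k x y = 0")
      case False
      have "(f x - g y)\<^sup>2 \<le> d\<^sup>2" using d[OF xy(2,3) False] by (metis abs_le_square_iff abs_ge_self order_trans)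
      then show ?thesis by (rule mult_left_mono[OF _ k_nonneg])
    qed simp
    then show "(case z of (x, y) \<Rightarrow> k x y * (f x - g y)\<^sup>2) \<le> (case z of (x, y) \<Rightarrow> k x y * d\<^sup>2)"
      by (simp add: xy)
  qed
  also have "\<dots> = d\<^sup>2"
    using pair_integral_fst[of "\<lambda>_. d\<^sup>2"] by (simp add: M.prob_space)
  finally have le: "L2_inner M f f - 2 * L2_inner nuN (A f) g + L2_inner nuN g g \<le> d\<^sup>2" .
  have "0 \<le> L2_inner nuN (\<lambda>y. 1 * A f y + (- 1) * g y) (\<lambda>y. 1 * A f y + (- 1) * g y)"
    by (rule L2_inner_self_nonneg)
  then have "0 \<le> L2_inner nuN (A f) (A f) - 2 * L2_inner nuN (A f) g + L2_inner nuN g g"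
    by (subst (asm) L2_inner_lincomb_self[OF A_L2_and_contraction(1)[OF f] g]) simp
  with le show ?thesis by simp
qed

end

section \<open>A Lipschitz test function\<close>

text \<open>\<open>S\<close> may be far from convex, so the mean value inequality is applied to a
  smooth extension on a ball, where compactness of a closed ball bounds the derivative.\<close>

lemma smooth_on_locally_lipschitz:
  fixes f :: "'a::euclidean_space \<Rightarrow> 'b::euclidean_space"
  assumes "smooth_on S f" "p \<in> S"
  shows "\<exists>r>0. \<exists>K. K-lipschitz_on (S \<inter> ball p r) f"
proof -
  obtain U g where U: "open U" "p \<in> U" and Ck: "\<And>k. Ck_on k U g" and eq: "\<And>y. y \<in> S \<inter> U \<Longrightarrow> g y = f y"
    using assms unfolding smooth_on_def by metis
  from Ck[of 1] have diff: "\<And>x. x \<in> U \<Longrightarrow> g differentiable (at x)"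
    and cont: "\<And>v. continuous_on U (\<lambda>x. frechet_derivative g (at x) v)"
    by auto
  obtain r where r: "r > 0" "cball p r \<subseteq> U"
    using U open_contains_cball by blast
  have "\<exists>C. \<forall>x\<in>cball p r. norm (frechet_derivative g (at x) b) \<le> C" for b
  proof -
    have "compact ((\<lambda>x. frechet_derivative g (at x) b) ` cball p r)"
      by (intro compact_continuous_image continuous_on_subset[OF cont r(2)] compact_cball)
    then show ?thesis by (auto dest!: compact_imp_bounded simp: bounded_iff)
  qed
  then obtain C where C: "\<And>b x. x \<in> cball p r \<Longrightarrow> norm (frechet_derivative g (at x) b) \<le> C b"
    by metis
  \<comment> \<open>\<open>Ck_on\<close> gives continuity of the derivative in each fixed direction;
    the sum of the bounds over the basis dominates the operator norm.\<close>
  define K where "K = (\<Sum>b\<in>Basis. C b)"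
  have C0: "0 \<le> C b" for b using C[of p b] r(1) norm_ge_zero order_trans by (metis centre_in_cball less_imp_le)
  have onorm: "onorm (frechet_derivative g (at x)) \<le> K" if x: "x \<in> ball p r" for x
  proof (rule onorm_le)
    fix v
    have "x \<in> U" using x r(2) by (auto simp: subset_iff)
    then interpret D: bounded_linear "frechet_derivative g (at x)"
      using diff has_derivative_bounded_linear frechet_derivative_works by blast
    have "norm (frechet_derivative g (at x) v) =
        norm (\<Sum>b\<in>Basis. (v \<bullet> b) *\<^sub>R frechet_derivative g (at x) b)"
      by (subst (1) euclidean_representation[of v, symmetric]) (simp only: D.sum D.scaleR)
    also have "\<dots> \<le> (\<Sum>b\<in>Basis. norm v * C b)"
    proof (rule sum_norm_le)
      fix b :: 'a assume b: "b \<in> Basis"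
      have "\<bar>v \<bullet> b\<bar> * norm (frechet_derivative g (at x) b) \<le> norm v * C b"
        using Basis_le_norm[OF b, of v] C[of x b] x by (intro mult_mono) auto
      then show "norm ((v \<bullet> b) *\<^sub>R frechet_derivative g (at x) b) \<le> norm v * C b" by simp
    qed
    finally show "norm (frechet_derivative g (at x) v) \<le> K * norm v"
      by (simp add: K_def sum_distrib_left mult.commute)
  qed
  have "K-lipschitz_on (S \<inter> ball p r) f"
  proof (rule lipschitz_onI)
    fix x y assume x: "x \<in> S \<inter> ball p r" and y: "y \<in> S \<inter> ball p r"
    have "norm (g x - g y) \<le> K * norm (x - y)"
    proof (rule differentiable_bound[OF convex_ball[of p r]])
      fix z assume z: "z \<in> ball p r"
      then have "z \<in> U" using r(2) by auto
      then show "(g has_derivative frechet_derivative g (at z)) (at z within ball p r)"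
        using diff frechet_derivative_works has_derivative_at_withinI by blast
    qed (use onorm x y in auto)
    moreover have "g x = f x" "g y = f y" using x y r(2) by (auto intro!: eq)
    ultimately show "dist (f x) (f y) \<le> K * dist x y" by (simp add: dist_norm)
  qed (simp add: K_def C0 sum_nonneg)
  with r show ?thesis by blast
qed

lemma smooth_on_differentiable_on:
  assumes "smooth_on V f" "open V"
  shows "f differentiable_on V"
  unfolding differentiable_on_def
proof
  fix x assume x: "x \<in> V"
  then obtain U g where U: "open U" "x \<in> U" and Ck: "\<And>k. Ck_on k U g" and eq: "\<And>y. y \<in> V \<inter> U \<Longrightarrow> g y = f y"
    using assms unfolding smooth_on_def by metis
  have "g differentiable (at x)" using Ck[of 1] U(2) by simp
  then obtain D where "(g has_derivative D) (at x)" by (auto simp: differentiable_def)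
  then have "(f has_derivative D) (at x)"
    by (rule has_derivative_transform_within_open[of _ _ _ _ "V \<inter> U"]) (use x U eq assms(2) in auto)
  then show "f differentiable at x within V"
    using differentiableI differentiable_at_withinI by blast
qed

text \<open>If \<open>k\<close> is below the full dimension, inverse charts map null sets to null
  sets and \<open>S\<close> is locally null. Otherwise \<open>H\<close> is the whole space, and a
  chart carries an open piece of a half-space into \<open>S\<close>.\<close>

lemma smooth_manifold_interior_nonempty:
  fixes S :: "'a::euclidean_space set"
  assumes S: "smooth_manifold_with_boundary k S" and nn: "\<not> negligible S"
  shows "interior S \<noteq> {}"
proof (cases "k < DIM('a)")
  case True
  have "\<exists>W. openin (top_of_set S) W \<and> p \<in> W \<and> negligible W" if "p \<in> S" for p
  proof -
    from S that obtain U V :: "'a set" and \<phi> \<psi> H e where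
      U: "open U" "p \<in> U" and V: "open V" and hom: "homeomorphism U V \<phi> \<psi>"
      and sm: "smooth_on V \<psi>" and H: "dim H = k"
      and im: "\<phi> ` (S \<inter> U) = V \<inter> {v \<in> H. v \<bullet> e \<ge> 0}"
      unfolding smooth_manifold_with_boundary_def by metis
    have sub: "S \<inter> U \<subseteq> \<psi> ` (V \<inter> H)"
    proof
      fix s assume s: "s \<in> S \<inter> U"
      then have "\<phi> s \<in> V \<inter> H" using im by blast
      moreover have "\<psi> (\<phi> s) = s" using hom s by (auto simp: homeomorphism_def)
      ultimately show "s \<in> \<psi> ` (V \<inter> H)" by (metis imageI)
    qed
    have "negligible (V \<inter> H)"
      using negligible_lowdim[of H] H True negligible_subset by blast
    then have "negligible (\<psi> ` (V \<inter> H))"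
      by (intro negligible_differentiable_image_negligible differentiable_on_subset[OF smooth_on_differentiable_on[OF sm V]])
         auto
    then have "negligible (S \<inter> U)" using sub negligible_subset by blast
    then show ?thesis using U that by (intro exI[of _ "S \<inter> U"]) auto
  qed
  \<comment> \<open>Passage from local to global negligibility.\<close>
  then have "negligible S" using locally_negligible_alt[of S] by blast
  with nn show ?thesis by simp
next
  case False
  from nn obtain p where "p \<in> S" by (metis negligible_empty ex_in_conv)
  with S obtain U V :: "'a set" and \<phi> \<psi> H e where
    U: "open U" "p \<in> U" and V: "open V" and hom: "homeomorphism U V \<phi> \<psi>"
    and H: "subspace H" "dim H = k"
    and im: "\<phi> ` (S \<inter> U) = V \<inter> {v \<in> H. v \<bullet> e \<ge> 0}"
    unfolding smooth_manifold_with_boundary_def by metis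
  have "dim H = DIM('a)" using False H(2) dim_subset_UNIV[of H] by simp
  then have HU: "H = UNIV" using H(1) by (metis dim_eq_full span_eq_iff)
  \<comment> \<open>The boundary hyperplane is discarded to get an open set. For
    \<open>e = 0\<close> the half-space is everything, and the strict inequality would leave
    nothing.\<close>
  define W where "W = V \<inter> (if e = 0 then UNIV else {v. e \<bullet> v > 0})"
  have W: "open W" using V open_halfspace_gt[of 0 e] by (auto simp: W_def)
  have pV: "\<phi> p \<in> V" "\<phi> p \<bullet> e \<ge> 0" using im \<open>p \<in> S\<close> U(2) by auto
  have "W \<noteq> {}"
  proof (cases "e = 0")
    case True
    then show ?thesis using pV by (auto simp: W_def)
  next
    case False
    obtain d where d: "d > 0" "ball (\<phi> p) d \<subseteq> V" using V pV(1) open_contains_ball by blast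
    \<comment> \<open>If \<open>\<phi> p\<close> is a boundary point, half the available distance in
      direction \<open>e\<close> leads strictly inside.\<close>
    define v where "v = \<phi> p + (d / 2 / norm e) *\<^sub>R e"
    have "dist (\<phi> p) v = d / 2" using False d(1) by (simp add: v_def dist_norm)
    then have "v \<in> V" using d by auto
    moreover have "0 < (d / 2 / norm e) * (e \<bullet> e)" using False d(1) by simp
    then have "e \<bullet> v > 0" using pV(2) by (simp add: v_def inner_add_right inner_commute)
    ultimately show ?thesis using False by (auto simp: W_def)
  qed
  have "open (U \<inter> \<phi> -` W)"
    using hom U(1) W by (intro continuous_open_preimage) (auto simp: homeomorphism_def)
  moreover have "U \<inter> \<phi> -` W \<subseteq> S"
  proof
    fix x assume x: "x \<in> U \<inter> \<phi> -` W"
    then have "\<phi> x \<in> V" "e = 0 \<or> e \<bullet> \<phi> x > 0"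
      by (auto simp: W_def split: if_splits)
    then have "\<phi> x \<in> \<phi> ` (S \<inter> U)"
      unfolding im by (auto simp: HU inner_commute[of "\<phi> x" e])
    then obtain s where s: "s \<in> S" "s \<in> U" "\<phi> x = \<phi> s" by blast
    then have "x = s" using hom x by (metis IntD1 homeomorphism_apply1)
    with s show "x \<in> S" by simp
  qed
  moreover obtain w where "w \<in> W" using \<open>W \<noteq> {}\<close> by blast
  then have "\<psi> w \<in> U \<inter> \<phi> -` W" using hom by (auto simp: homeomorphism_def W_def)
  ultimately show ?thesis by (metis empty_iff interior_maximal subsetD)
qed

text \<open>Only the inverse is known to be regular, so the test function is a bump in the domain, placed
  inside the open image of a small ball under the inverse, and transported forward.\<close>

lemma lipschitz_test_function_exists:
  fixes T :: "'a::euclidean_space \<Rightarrow> 'a"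
  assumes XW: "X \<subseteq> W" and inj: "inj_on T W" and sm: "smooth_on (T ` W) (inv_into W T)"
    and int: "interior (T ` X) \<noteq> {}"
  shows "\<exists>x0 r K g. r > 0 \<and> ball x0 r \<subseteq> X \<and> K-lipschitz_on UNIV g \<and>
    (\<forall>z\<in>W. g (T z) = max 0 (r - dist x0 z))"
proof -
  define S where "S = inv_into W T"
  have ST: "S (T z) = z" if "z \<in> W" for z using that inj by (simp add: S_def)
  obtain p where p: "p \<in> interior (T ` X)" using int by blast
  then obtain R0 where R0: "R0 > 0" "ball p R0 \<subseteq> T ` X" by (auto simp: mem_interior)
  have "p \<in> T ` W" using p XW interior_subset by blast
  then obtain R1 K1 where R1: "R1 > 0" and K1: "K1-lipschitz_on (T ` W \<inter> ball p R1) S"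
    using smooth_on_locally_lipschitz[OF sm] unfolding S_def by blast
  \<comment> \<open>Within this radius points have preimages in \<open>X\<close> and the inverse is
    Lipschitz.\<close>
  define R where "R = min R0 R1"
  have R: "R > 0" "ball p R \<subseteq> T ` X" "K1-lipschitz_on (ball p R) S"
  proof -
    show "R > 0" using R0 R1 by (simp add: R_def)
    show sub: "ball p R \<subseteq> T ` X" using R0(2) by (auto simp: R_def)
    show "K1-lipschitz_on (ball p R) S"
      by (rule lipschitz_on_subset[OF K1]) (use sub XW in \<open>auto simp: R_def\<close>)
  qed
  have TS: "T (S y) = y" "S y \<in> X" if "y \<in> ball p R" for y
    using that R(2) XW ST by force+
  \<comment> \<open>Invariance of domain yields room for a bump around \<open>x0\<close> in the
    domain. The halved radius leaves a collar of width \<open>R / 2\<close> between the support of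
    \<open>g\<close> and the region where no Lipschitz bound for \<open>S\<close> is at
    hand.\<close>
  have "open (S ` ball p (R / 2))"
  proof (rule invariance_of_domain)
    have sub: "ball p (R / 2) \<subseteq> ball p R" using R(1) by (intro subset_ball) simp
    then show "continuous_on (ball p (R / 2)) S"
      using lipschitz_on_continuous_on[OF R(3)] continuous_on_subset by blast
    show "inj_on S (ball p (R / 2))" using TS(1) sub by (metis inj_on_inverseI subsetD)
  qed simp
  moreover define x0 where "x0 = S p"
  moreover have "x0 \<in> S ` ball p (R / 2)" using R(1) by (simp add: x0_def)
  ultimately obtain r where r: "r > 0" "ball x0 r \<subseteq> S ` ball p (R / 2)"
    using open_contains_ball by blast
  have half: "z \<in> X \<and> T z \<in> ball p (R / 2)" if z: "z \<in> ball x0 r" for z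
  proof -
    obtain y where y: "y \<in> ball p (R / 2)" "z = S y" using z r(2) by blast
    then have "y \<in> ball p R" using R(1) by auto
    from TS[OF this] y show ?thesis by simp
  qed
  define f where "f z = max 0 (r - dist x0 z)" for z
  define V where "V = T ` ball x0 r"
  define g where "g y = (if y \<in> V then f (S y) else 0)" for y
  \<comment> \<open>\<open>K1\<close> serves two points inside \<open>ball p R\<close>;
    \<open>2 * r / R\<close> pays for a drop of at most \<open>r\<close> across the collar.\<close>
  define K where "K = K1 + 2 * r / R"
  have K1_0: "0 \<le> K1" using R(3) lipschitz_on_nonneg by blast
  have gT: "g (T z) = f z" if z: "z \<in> W" for z
  proof (cases "z \<in> ball x0 r")
    case True
    then show ?thesis using ST[OF z] by (simp add: g_def V_def)
  next
    case False
    \<comment> \<open>Injectivity on all of \<open>W\<close> prevents points outside the bump from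
      landing on its image.\<close>
    have "T z \<notin> V"
    proof
      assume "T z \<in> V"
      then obtain z' where z': "z' \<in> ball x0 r" "T z = T z'" by (auto simp: V_def)
      then have "z = z'" using inj z half XW by (meson inj_onD subsetD)
      with z' False show False by simp
    qed
    then show ?thesis using False by (simp add: g_def f_def)
  qed
  have g0: "0 \<le> g y" for y by (simp add: g_def f_def)
  have le: "g y - g y' \<le> K * dist y y'" for y y'
  proof (cases "y \<in> V")
    case False
    then have "g y - g y' \<le> 0" using g0[of y'] by (simp add: g_def)
    also have "0 \<le> K * dist y y'" using K1_0 r(1) R(1) by (simp add: K_def)
    finally show ?thesis .
  next
    case True
    then have y: "y \<in> ball p (R / 2)" using half by (auto simp: V_def)
    show ?thesis
    proof (cases "y' \<in> ball p R")
      case False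
      have "dist p y' \<le> dist p y + dist y y'" by (rule dist_triangle)
      then have d: "R / 2 \<le> dist y y'" using y False by simp
      have "g y \<le> r" using r(1) by (simp add: g_def f_def)
      then have "g y - g y' \<le> (2 * r / R) * (R / 2)" using g0[of y'] R(1) by simp
      also have "\<dots> \<le> K * dist y y'"
        using d K1_0 r(1) R(1) by (intro mult_mono) (auto simp: K_def)
      finally show ?thesis .
    next
      case y': True
      have yR: "y \<in> ball p R" using y R(1) by auto
      have "g y = f (S y)" "g y' = f (S y')"
        using gT[of "S y"] gT[of "S y'"] TS[OF yR] TS[OF y'] XW by auto
      then have "g y - g y' \<le> dist (S y) (S y')"
        using dist_triangle[of x0 "S y'" "S y"] zero_le_dist[of "S y" "S y'"] unfolding f_def by linarith
      also have "\<dots> \<le> K1 * dist y y'" by (rule lipschitz_onD[OF R(3) yR y'])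
      also have "\<dots> \<le> K * dist y y'" using r(1) R(1) by (intro mult_right_mono) (auto simp: K_def)
      finally show ?thesis .
    qed
  qed
  have "K-lipschitz_on UNIV g"
  proof (rule lipschitz_onI)
    show "dist (g y) (g y') \<le> K * dist y y'" for y y'
      using le[of y y'] le[of y' y] by (simp add: dist_real_def dist_commute abs_le_iff)
  qed (use K1_0 r(1) R(1) in \<open>simp add: K_def\<close>)
  moreover have "ball x0 r \<subseteq> X" using half by blast
  ultimately show ?thesis
    using r(1) gT unfolding f_def by (intro exI[of _ x0] exI[of _ r] exI[of _ K] exI[of _ g]) auto
qed

section \<open>The kernel of the smoothed transfer operator\<close>

lemma alpha_measurable [measurable]: "alpha \<epsilon> \<in> borel_measurable borel"
  unfolding alpha_def[abs_def]
  by (intro borel_measurable_divide borel_measurable_indicator borel_measurable_const borel_open open_ball)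

lemma alpha_nonneg: "0 \<le> alpha \<epsilon> x"
  by (simp add: alpha_def)

lemma alpha_le: "alpha \<epsilon> (x :: 'a::euclidean_space) \<le> 1 / measure lebesgue (ball (0::'a) \<epsilon>)"
  by (auto simp: alpha_def indicator_def divide_right_mono)

lemma alpha_neq_0D: "alpha \<epsilon> (x - y) \<noteq> 0 \<Longrightarrow> dist x y < \<epsilon>"
  by (auto simp: alpha_def dist_norm norm_minus_commute indicator_def split: if_splits)

lemma measure_lebesgue_ball_pos: "r > 0 \<Longrightarrow> measure lebesgue (ball x r) > 0"
  using content_ball_pos[of r x] by simp

lemma measure_lebesgue_ball_center:
  "measure lebesgue (ball (x::'a::euclidean_space) r) = measure lebesgue (ball (0::'a) r)"
  using measure_translation[of x "ball 0 r"] by (simp add: ball_translation[of 0 x, symmetric] image_add_ball)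

lemma alpha_integral:
  fixes w :: "'a::euclidean_space"
  assumes "S \<in> sets lebesgue"
  shows "(\<integral>y. alpha \<epsilon> (y - w) \<partial>lebesgue_on S) =
    measure lebesgue (ball w \<epsilon> \<inter> S) / measure lebesgue (ball (0::'a) \<epsilon>)"
proof -
  have "(\<integral>y. alpha \<epsilon> (y - w) \<partial>lebesgue_on S) =
      (\<integral>y. indicator (ball w \<epsilon> \<inter> S) y / measure lebesgue (ball (0::'a) \<epsilon>) \<partial>lebesgue)"
    using assms by (subst integral_restrict_space)
      (auto intro!: Bochner_Integration.integral_cong
         simp: alpha_def indicator_def dist_norm norm_minus_commute)
  also have "\<dots> = measure lebesgue (ball w \<epsilon> \<inter> S) / measure lebesgue (ball (0::'a) \<epsilon>)"
    by simp
  finally show ?thesis .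
qed

text \<open>The diffused indicator at \<open>y\<close> is the fraction of the ball around
  \<open>y\<close> filled by \<open>X\<close>, and positivity of the filled measure survives
  enlarging the radius. Thus identities known on the set for \<open>eps_star\<close> hold for every
  smaller \<epsilon>.\<close>

lemma X_eps_mono:
  fixes X :: "'a::euclidean_space set"
  assumes X: "X \<in> sets lebesgue" and \<epsilon>: "0 < \<epsilon>" "\<epsilon> \<le> \<delta>"
  shows "X_eps X \<epsilon> \<subseteq> X_eps X \<delta>"
proof -
  have diffusion: "diffusion X e (indicator X) y =
      measure lebesgue (ball y e \<inter> X) / measure lebesgue (ball (0::'a) e)" for e y
  proof -
    have "diffusion X e (indicator X) y = (\<integral>x. alpha e (x - y) \<partial>lebesgue_on X)"
      unfolding diffusion_def set_lebesgue_integral_def using X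
      by (subst integral_restrict_space)
        (auto intro!: Bochner_Integration.integral_cong
          simp: alpha_def indicator_def norm_minus_commute)
    then show ?thesis by (simp add: alpha_integral[OF X])
  qed
  have "diffusion X \<delta> (indicator X) y \<noteq> 0" if "diffusion X \<epsilon> (indicator X) y \<noteq> 0" for y
  proof -
    have "measure lebesgue (ball y \<epsilon> \<inter> X) \<noteq> 0" using that by (auto simp: diffusion)
    moreover have "measure lebesgue (ball y \<epsilon> \<inter> X) \<le> measure lebesgue (ball y \<delta> \<inter> X)"
      using X \<epsilon> by (intro measure_mono_fmeasurable) (auto simp: fmeasurable_Int_fmeasurable)
    ultimately have "measure lebesgue (ball y \<delta> \<inter> X) > 0"
      by (smt (verit) measure_nonneg)
    then show ?thesis
      using measure_lebesgue_ball_pos[of \<delta> "0::'a"] \<epsilon> by (simp add: diffusion)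
  qed
  then show ?thesis unfolding X_eps_def supp_def by (intro closure_mono) auto
qed

locale smoothed_transfer =
  fixes M X :: "'a::euclidean_space set" and T :: "'a \<Rightarrow> 'a" and h :: "'a \<Rightarrow> real" and \<epsilon> :: real
  assumes eps_pos: "0 < \<epsilon>" and M: "compact M" and X_sub: "X \<subseteq> M" and X_sets: "X \<in> sets lebesgue"
    and T: "T \<in> borel_measurable (lebesgue_on M)"
    and h_meas: "h \<in> borel_measurable (lebesgue_on X)"
    and h_nonneg: "AE x in lebesgue_on X. 0 \<le> h x"
    and prob: "prob_space (mu X h)"
    and W_sub: "X_eps X \<epsilon> \<subseteq> M" and Y_sub: "Y_eps X T \<epsilon> \<subseteq> M"
    and ball_W: "\<And>x. x \<in> X \<Longrightarrow> ball x \<epsilon> \<subseteq> X_eps X \<epsilon>"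
    and ball_Y: "\<And>z. z \<in> X_eps X \<epsilon> \<Longrightarrow> ball (T z) \<epsilon> \<subseteq> Y_eps X T \<epsilon>"
begin

abbreviation "W \<equiv> X_eps X \<epsilon>"
abbreviation "Y \<equiv> Y_eps X T \<epsilon>"
abbreviation "\<mu> \<equiv> mu X h"
abbreviation "k \<equiv> kernel X T \<epsilon>"
definition "c = 1 / measure lebesgue (ball (0::'a) \<epsilon>)"

sublocale \<mu>: prob_space \<mu> by (rule prob)

lemma c_pos: "c > 0"
  using measure_lebesgue_ball_pos[OF eps_pos] by (simp add: c_def)

lemma alpha_le_c: "alpha \<epsilon> (x::'a) \<le> c"
  unfolding c_def by (rule alpha_le)

text \<open>Supports are closures, hence compact inside \<open>M\<close>; this makes Lebesgue
  measure on \<open>W\<close> and \<open>Y\<close> finite.\<close>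

lemma closed_lmeasurable: "closed S \<Longrightarrow> S \<subseteq> M \<Longrightarrow> S \<in> lmeasurable"
  using M by (metis compact_Int_closed inf.absorb_iff2 lmeasurable_compact)

lemma W_lmeasurable: "W \<in> lmeasurable"
  by (rule closed_lmeasurable[OF _ W_sub]) (simp add: X_eps_def supp_def)

lemma Y_lmeasurable: "Y \<in> lmeasurable"
  by (rule closed_lmeasurable[OF _ Y_sub]) (simp add: Y_eps_def supp_def)

sublocale W: finite_measure "lebesgue_on W"
  by (rule finite_measure_lebesgue_on[OF W_lmeasurable])

sublocale Y: finite_measure "lebesgue_on Y"
  by (rule finite_measure_lebesgue_on[OF Y_lmeasurable])

lemma sets_mu [measurable_cong]: "sets \<mu> = sets (lebesgue_on X)"
  by (simp add: mu_def)

lemma space_mu [simp]: "space \<mu> = X"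
  by (simp add: mu_def)

lemma id_measurable_lebesgue_on [measurable]: "(\<lambda>x. x) \<in> lebesgue_on S \<rightarrow>\<^sub>M borel"
  using id_borel_measurable_lebesgue_on[of S] by (simp add: id_def)

lemma id_measurable_mu [measurable]: "(\<lambda>x. x) \<in> \<mu> \<rightarrow>\<^sub>M borel"
  using id_measurable_lebesgue_on[of X] by (simp cong: measurable_cong_sets add: measurable_cong_sets[OF sets_mu refl])

lemma T_measurable_W [measurable]: "T \<in> borel_measurable (lebesgue_on W)"
  by (rule measurable_restrict_mono[OF T W_sub])

section \<open>The kernel as a bounded Markov density\<close>

lemma k_eq: "k x y = (\<integral>z. alpha \<epsilon> (y - T z) * alpha \<epsilon> (z - x) \<partial>lebesgue_on W)"
  unfolding kernel_def set_lebesgue_integral_def using W_lmeasurable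
  by (subst integral_restrict_space) auto

text \<open>\<open>T\<close> is only Lebesgue measurable, but it acts on the integrated variable.
  Joint measurability in \<open>x\<close> and \<open>y\<close> can thus be shown for Borel sets and
  then pulled back.\<close>

lemma k_borel [measurable]: "case_prod k \<in> borel_measurable (borel \<Otimes>\<^sub>M borel)"
proof -
  have "(\<lambda>p. \<integral>z. alpha \<epsilon> (snd p - T z) * alpha \<epsilon> (z - fst p) \<partial>lebesgue_on W)
      \<in> borel_measurable (borel \<Otimes>\<^sub>M borel)"
    by measurable
  then show ?thesis by (simp add: k_eq[abs_def] case_prod_beta')
qed

lemma k_measurable [measurable]: "case_prod k \<in> borel_measurable (\<mu> \<Otimes>\<^sub>M lebesgue_on Y)"
proof -
  have "(\<lambda>p. (fst p, snd p)) \<in> \<mu> \<Otimes>\<^sub>M lebesgue_on Y \<rightarrow>\<^sub>M borel \<Otimes>\<^sub>M borel"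
    using measurable_compose[OF measurable_fst id_measurable_mu]
      measurable_compose[OF measurable_snd id_measurable_lebesgue_on]
    by (intro measurable_Pair) auto
  from measurable_compose[OF this k_borel] show ?thesis by (simp add: case_prod_beta')
qed

lemma k_measurable_fst [measurable]: "(\<lambda>x. k x y) \<in> borel_measurable \<mu>"
proof -
  have "(\<lambda>x. (x, y)) \<in> \<mu> \<rightarrow>\<^sub>M borel \<Otimes>\<^sub>M borel"
    by (intro measurable_Pair id_measurable_mu) auto
  from measurable_compose[OF this k_borel] show ?thesis by simp
qed

lemma alpha_integrable_W: "integrable (lebesgue_on W) (\<lambda>z. alpha \<epsilon> (z - x))"
  by (rule W.integrable_const_bound[where B = c]) (auto simp: alpha_nonneg alpha_le_c)

lemma alpha_integral_W_le: "(\<integral>z. alpha \<epsilon> (z - x) \<partial>lebesgue_on W) \<le> 1"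
proof -
  have "measure lebesgue (ball x \<epsilon> \<inter> W) \<le> measure lebesgue (ball x \<epsilon>)"
    using W_lmeasurable by (intro measure_mono_fmeasurable) auto
  then show ?thesis
    using measure_lebesgue_ball_pos[OF eps_pos, of "0::'a"] W_lmeasurable
    by (subst alpha_integral) (auto simp: measure_lebesgue_ball_center[of x])
qed

lemma alpha_integral_eq_1:
  assumes "S \<in> lmeasurable" "ball x \<epsilon> \<subseteq> S"
  shows "(\<integral>z. alpha \<epsilon> (z - x) \<partial>lebesgue_on S) = 1"
proof -
  have "ball x \<epsilon> \<inter> S = ball x \<epsilon>" using assms by auto
  then show ?thesis
    using measure_lebesgue_ball_pos[OF eps_pos, of "0::'a"] assms
    by (subst alpha_integral) (auto simp: measure_lebesgue_ball_center[of x])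
qed

lemma k_nonneg: "0 \<le> k x y"
  by (simp add: k_eq alpha_nonneg)

text \<open>One factor is bounded by \<open>c\<close>, and the other has integral at most 1.\<close>

lemma k_le: "k x y \<le> c"
proof -
  have "k x y \<le> (\<integral>z. c * alpha \<epsilon> (z - x) \<partial>lebesgue_on W)"
    unfolding k_eq
  proof (rule integral_mono)
    show "integrable (lebesgue_on W) (\<lambda>z. alpha \<epsilon> (y - T z) * alpha \<epsilon> (z - x))"
      by (rule W.integrable_const_bound[where B = "c * c"])
        (use c_pos in \<open>auto simp: abs_mult alpha_nonneg alpha_le_c intro!: mult_mono\<close>)
  qed (auto simp: alpha_integrable_W alpha_nonneg alpha_le_c mult_right_mono)
  also have "\<dots> \<le> c * 1"
    using c_pos alpha_integral_W_le[of x] by (simp add: mult_left_le)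
  finally show ?thesis by simp
qed

text \<open>After exchanging the integrals, \<open>ball_Y\<close> and \<open>ball_W\<close> say that
  neither jump loses mass outside the domain.\<close>

lemma k_integral:
  assumes x: "x \<in> X"
  shows "(\<integral>y. k x y \<partial>lebesgue_on Y) = 1"
proof -
  interpret P: pair_sigma_finite "lebesgue_on Y" "lebesgue_on W" ..
  interpret F: finite_measure "lebesgue_on Y \<Otimes>\<^sub>M lebesgue_on W"
    by (rule finite_measure_pair_measure) unfold_locales
  have int: "integrable (lebesgue_on Y \<Otimes>\<^sub>M lebesgue_on W) (\<lambda>(y, z). alpha \<epsilon> (y - T z) * alpha \<epsilon> (z - x))"
  proof (rule F.integrable_const_bound[where B = "c * c"])
    show "(\<lambda>(y, z). alpha \<epsilon> (y - T z) * alpha \<epsilon> (z - x)) \<in> borel_measurable (lebesgue_on Y \<Otimes>\<^sub>M lebesgue_on W)"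
      by measurable
    show "AE p in lebesgue_on Y \<Otimes>\<^sub>M lebesgue_on W.
        norm (case p of (y, z) \<Rightarrow> alpha \<epsilon> (y - T z) * alpha \<epsilon> (z - x)) \<le> c * c"
      by (rule AE_I2)
        (use c_pos in \<open>auto simp: abs_mult alpha_nonneg alpha_le_c intro!: mult_mono\<close>)
  qed
  have "(\<integral>y. k x y \<partial>lebesgue_on Y) =
      (\<integral>z. (\<integral>y. alpha \<epsilon> (y - T z) * alpha \<epsilon> (z - x) \<partial>lebesgue_on Y) \<partial>lebesgue_on W)"
    unfolding k_eq using P.Fubini_integral[OF int] by simp
  also have "\<dots> = (\<integral>z. alpha \<epsilon> (z - x) \<partial>lebesgue_on W)"
    by (intro Bochner_Integration.integral_cong refl)
      (simp add: alpha_integral_eq_1[OF Y_lmeasurable ball_Y])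
  also have "\<dots> = 1" by (rule alpha_integral_eq_1[OF W_lmeasurable ball_W[OF x]])
  finally show ?thesis .
qed

sublocale K: bounded_markov_kernel \<mu> "lebesgue_on Y" k c
  by unfold_locales (use k_measurable k_nonneg k_le k_integral in auto)

lemma integral_mu:
  assumes "f \<in> borel_measurable \<mu>"
  shows "(\<integral>x. f x \<partial>\<mu>) = (LINT x:X|lebesgue. f x * h x)"
proof -
  have "f \<in> borel_measurable (lebesgue_on X)"
    using assms by (simp add: measurable_cong_sets[OF sets_mu refl])
  then have "(\<integral>x. f x \<partial>\<mu>) = (\<integral>x. h x * f x \<partial>lebesgue_on X)"
    unfolding mu_def using h_meas h_nonneg by (rule integral_real_density[rotated 2])
  also have "\<dots> = (LINT x:X|lebesgue. f x * h x)"
    unfolding set_lebesgue_integral_def using X_sets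
    by (subst integral_restrict_space) (auto simp: mult.commute)
  finally show ?thesis .
qed

lemma h_nu_eq: "h_nu X h T \<epsilon> = K.hn"
  by (rule ext) (simp add: h_nu_def K.hn_def integral_mu[OF k_measurable_fst])

lemma nu_eq: "nu X h T \<epsilon> = K.nuN"
  by (simp add: nu_def K.nuN_def h_nu_eq)

lemma L_eps_eq:
  assumes "f \<in> L2 \<mu>"
  shows "L_eps X h T \<epsilon> f = K.A f"
proof
  fix y
  have [measurable]: "f \<in> borel_measurable \<mu>" using assms by auto
  have "(\<lambda>x. k x y * f x) \<in> borel_measurable \<mu>" by measurable
  then show "L_eps X h T \<epsilon> f y = K.A f y"
    by (simp add: L_eps_def K.A_def h_nu_eq integral_mu)
qed

lemma AE_mu: "(AE x in lebesgue_on X. P x) \<Longrightarrow> AE x in \<mu>. P x"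
  unfolding mu_def using h_meas by (subst AE_density) auto

section \<open>Compactness from the first diffusion\<close>

text \<open>The part of the operator that precedes \<open>T\<close>: the first diffusion of the
  density \<open>f * h\<close>.\<close>

definition F :: "('a \<Rightarrow> real) \<Rightarrow> 'a \<Rightarrow> real" where
  "F f z = (\<integral>x. alpha \<epsilon> (z - x) * f x \<partial>\<mu>)"

text \<open>Squared \<open>L2\<close> distance of two translates of the averaging function, used as
  a modulus of continuity of \<open>F f\<close> common to all unit vectors \<open>f\<close>.\<close>

definition D :: "'a \<Rightarrow> 'a \<Rightarrow> real" where
  "D z z' = (\<integral>x. (alpha \<epsilon> (z - x) - alpha \<epsilon> (z' - x))\<^sup>2 \<partial>\<mu>)"

lemma alpha_measurable_mu [measurable]: "(\<lambda>x. alpha \<epsilon> (z - x)) \<in> borel_measurable \<mu>"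
  by measurable

lemma alpha_L2: "(\<lambda>x. alpha \<epsilon> (z - x)) \<in> L2 \<mu>"
proof -
  have "norm ((alpha \<epsilon> (z - x))\<^sup>2) \<le> c\<^sup>2" for x
    using power_mono[OF alpha_le_c alpha_nonneg, of "z - x" 2] by simp
  then have "integrable \<mu> (\<lambda>x. (alpha \<epsilon> (z - x))\<^sup>2)"
    by (intro \<mu>.integrable_const_bound[where B = "c\<^sup>2"] AE_I2) measurable
  then show ?thesis by (simp add: L2_def)
qed

lemma F_bound:
  assumes f: "f \<in> L2 \<mu>" "L2_inner \<mu> f f = 1"
  shows "\<bar>F f z\<bar> \<le> c"
proof -
  have "L2_inner \<mu> (\<lambda>x. alpha \<epsilon> (z - x)) (\<lambda>x. alpha \<epsilon> (z - x)) \<le> (\<integral>x. c * c \<partial>\<mu>)"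
    unfolding L2_inner_def using c_pos
    by (intro integral_mono L2_mult_integrable[OF alpha_L2 alpha_L2] mult_mono)
      (auto simp: alpha_nonneg alpha_le_c)
  also have "\<dots> = c\<^sup>2" using \<mu>.prob_space by (simp add: power2_eq_square)
  finally have "(F f z)\<^sup>2 \<le> c\<^sup>2"
    using L2_inner_Cauchy_Schwarz[OF alpha_L2 f(1), of z] f(2) by (simp add: F_def L2_inner_def)
  then show ?thesis using c_pos abs_le_square_iff[of "F f z" c] by simp
qed

text \<open>By Cauchy-Schwarz; the bound is free of \<open>f\<close>, which is
  equicontinuity.\<close>

lemma F_diff:
  assumes f: "f \<in> L2 \<mu>" "L2_inner \<mu> f f = 1"
  shows "(F f z - F f z')\<^sup>2 \<le> D z z'"
proof -
  let ?a = "\<lambda>x. 1 * alpha \<epsilon> (z - x) + (- 1) * alpha \<epsilon> (z' - x)"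
  have "L2_inner \<mu> ?a f = F f z - F f z'"
    using L2_inner_lincomb_left[OF alpha_L2 alpha_L2 f(1), of 1 z "-1" z']
    by (simp add: F_def L2_inner_def)
  moreover have "L2_inner \<mu> ?a ?a = D z z'"
    by (simp add: L2_inner_def D_def power2_eq_square)
  ultimately show ?thesis
    using L2_inner_Cauchy_Schwarz[OF L2_lincomb[OF alpha_L2 alpha_L2] f(1), of 1 z "-1" z'] f(2)
    by simp
qed

lemma alpha_eventually_const:
  assumes u: "u \<longlonglongrightarrow> z" and x: "x \<notin> sphere z \<epsilon>"
  shows "\<forall>\<^sub>F n in sequentially. alpha \<epsilon> (u n - x) = alpha \<epsilon> (z - x)"
proof -
  have lim: "(\<lambda>n. norm (u n - x)) \<longlonglongrightarrow> norm (z - x)" by (intro tendsto_intros u)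
  have "norm (z - x) \<noteq> \<epsilon>" using x by (simp add: dist_norm)
  then consider "norm (z - x) < \<epsilon>" | "norm (z - x) > \<epsilon>" by linarith
  then show ?thesis
  proof cases
    case 1
    from order_tendstoD(2)[OF lim 1] show ?thesis
      by eventually_elim (use 1 in \<open>simp add: alpha_def\<close>)
  next
    case 2
    from order_tendstoD(1)[OF lim 2] show ?thesis
      by eventually_elim (use 2 in \<open>simp add: alpha_def\<close>)
  qed
qed

text \<open>The averaging function jumps only across a sphere, which is null for Lebesgue measure
  and hence for \<open>\<mu>\<close>. Off it the integrand is eventually 0.\<close>

lemma D_tendsto_0:
  assumes u: "u \<longlonglongrightarrow> z"
  shows "(\<lambda>n. D z (u n)) \<longlonglongrightarrow> 0"
proof -
  have "AE x in lebesgue. x \<notin> sphere z \<epsilon>"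
    by (rule AE_not_in[OF negligible_sphere[unfolded negligible_iff_null_sets]])
  then have "AE x in lebesgue_on X. x \<notin> sphere z \<epsilon>"
    using X_sets by (subst AE_restrict_space_iff) auto
  then have ae: "AE x in \<mu>. x \<notin> sphere z \<epsilon>" by (rule AE_mu)
  have "(\<lambda>n. \<integral>x. (alpha \<epsilon> (z - x) - alpha \<epsilon> (u n - x))\<^sup>2 \<partial>\<mu>) \<longlonglongrightarrow> (\<integral>x. 0 \<partial>\<mu>)"
  proof (rule integral_dominated_convergence)
    show "integrable \<mu> (\<lambda>_. c\<^sup>2)" by simp
    show "AE x in \<mu>. (\<lambda>n. (alpha \<epsilon> (z - x) - alpha \<epsilon> (u n - x))\<^sup>2) \<longlonglongrightarrow> 0"
      using ae
    proof eventually_elim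
      case (elim x)
      from alpha_eventually_const[OF u elim] show ?case
        by (intro tendsto_eventually) (auto elim: eventually_mono)
    qed
    show "AE x in \<mu>. norm ((alpha \<epsilon> (z - x) - alpha \<epsilon> (u n - x))\<^sup>2) \<le> c\<^sup>2" for n
    proof (rule AE_I2)
      fix x
      have "\<bar>alpha \<epsilon> (z - x) - alpha \<epsilon> (u n - x)\<bar> \<le> c"
        using alpha_nonneg[of \<epsilon> "z - x"] alpha_nonneg[of \<epsilon> "u n - x"]
          alpha_le_c[of "z - x"] alpha_le_c[of "u n - x"] by linarith
      then show "norm ((alpha \<epsilon> (z - x) - alpha \<epsilon> (u n - x))\<^sup>2) \<le> c\<^sup>2"
        using power_mono[of "\<bar>alpha \<epsilon> (z - x) - alpha \<epsilon> (u n - x)\<bar>" c 2] by simp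
    qed
  qed measurable
  then show ?thesis by (simp add: D_def)
qed

lemma D_small:
  assumes "e > 0"
  shows "\<exists>d>0. \<forall>q\<in>ball z d. D z q < e"
proof -
  have "D z z = 0" by (simp add: D_def)
  then have "isCont (D z) z"
    using D_tendsto_0 by (intro continuous_at_sequentiallyI) simp
  then obtain d where "d > 0" "\<And>q. dist q z < d \<Longrightarrow> dist (D z q) (D z z) < e"
    using assms unfolding continuous_at_eps_delta by blast
  then show ?thesis
    using \<open>D z z = 0\<close> by (intro exI[of _ d]) (auto simp: dist_commute dist_real_def abs_less_iff)
qed

text \<open>The pointwise half of Arzela-Ascoli: a diagonal sequence converges on a countable dense
  set, and the common modulus \<open>D\<close> extends this to every point.\<close>

lemma F_convergent_subsequence:
  assumes f: "\<And>n. f n \<in> L2 \<mu>" "\<And>n. L2_inner \<mu> (f n) (f n) = 1"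
  shows "\<exists>s. strict_mono (s :: nat \<Rightarrow> nat) \<and> (\<forall>z. convergent (\<lambda>n. F (f (s n)) z))"
proof -
  obtain Q :: "'a set" where Q: "countable Q" "\<And>S. open S \<Longrightarrow> S \<noteq> {} \<Longrightarrow> \<exists>d\<in>Q. d \<in> S"
    using countable_dense_setE by blast
  obtain s where s: "strict_mono (s :: nat \<Rightarrow> nat)"
      and conv: "\<And>q. q \<in> Q \<Longrightarrow> \<exists>l. (\<lambda>n. F (f (s n)) q) \<longlonglongrightarrow> l"
    using function_convergent_subsequence[of Q "\<lambda>n. F (f n)" c] Q(1) F_bound[OF f] by auto
  have "Cauchy (\<lambda>n. F (f (s n)) z)" for z
  proof (rule metric_CauchyI)
    fix e :: real assume e: "e > 0"
    obtain d where d: "d > 0" "\<forall>q\<in>ball z d. D z q < (e / 3)\<^sup>2"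
      using D_small[of "(e / 3)\<^sup>2" z] e by auto
    obtain q where q: "q \<in> Q" "q \<in> ball z d"
      using Q(2)[of "ball z d"] d(1) by auto
    have near: "\<bar>F (f n) z - F (f n) q\<bar> < e / 3" for n
    proof -
      have "(F (f n) z - F (f n) q)\<^sup>2 < (e / 3)\<^sup>2"
        using F_diff[OF f, of n z q] d(2) q(2) by fastforce
      then have "\<bar>F (f n) z - F (f n) q\<bar>\<^sup>2 < (e / 3)\<^sup>2" by simp
      then show ?thesis by (rule power_less_imp_less_base) (use e in simp)
    qed
    have "Cauchy (\<lambda>n. F (f (s n)) q)" using conv[OF q(1)] by (auto intro: LIMSEQ_imp_Cauchy)
    then obtain N where N: "\<And>m n. m \<ge> N \<Longrightarrow> n \<ge> N \<Longrightarrow> dist (F (f (s m)) q) (F (f (s n)) q) < e / 3"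
      using e by (meson metric_CauchyD divide_pos_pos zero_less_numeral)
    have "dist (F (f (s m)) z) (F (f (s n)) z) < e" if "m \<ge> N" "n \<ge> N" for m n
      using N[OF that] near[of "s m"] near[of "s n"] unfolding dist_real_def by linarith
    then show "\<exists>N. \<forall>m\<ge>N. \<forall>n\<ge>N. dist (F (f (s m)) z) (F (f (s n)) z) < e" by blast
  qed
  with s show ?thesis by (auto simp: Cauchy_convergent_iff)
qed

lemma F_measurable [measurable]:
  assumes [measurable]: "f \<in> borel_measurable \<mu>"
  shows "F f \<in> borel_measurable borel"
proof -
  have "(\<lambda>(z, x). alpha \<epsilon> (z - x) * f x) \<in> borel_measurable (borel \<Otimes>\<^sub>M \<mu>)" by measurable
  then show ?thesis
    unfolding F_def[abs_def] by (rule \<mu>.borel_measurable_lebesgue_integral)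
qed

text \<open>Factors the unnormalised operator through \<open>F\<close>, so that pointwise limits of
  \<open>F\<close> pass through the remaining integral by dominated convergence, whatever the
  regularity of \<open>T\<close>.\<close>

lemma integral_k_eq_F:
  assumes f: "f \<in> L2 \<mu>"
  shows "(\<integral>x. k x y * f x \<partial>\<mu>) = (\<integral>z. alpha \<epsilon> (y - T z) * F f z \<partial>lebesgue_on W)"
proof -
  interpret P: pair_sigma_finite \<mu> "lebesgue_on W" ..
  have [measurable]: "f \<in> borel_measurable \<mu>" using f by auto
  have intf: "integrable \<mu> f" by (rule K.L2_integrable[OF f])
  have int1: "integrable (\<mu> \<Otimes>\<^sub>M lebesgue_on W) (\<lambda>(x, z). (c * c) * f x)"
    by (rule P.Fubini_integrable) (use intf in \<open>auto simp: abs_mult\<close>)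
  have int: "integrable (\<mu> \<Otimes>\<^sub>M lebesgue_on W) (\<lambda>(x, z). alpha \<epsilon> (y - T z) * alpha \<epsilon> (z - x) * f x)"
  proof (rule Bochner_Integration.integrable_bound[OF int1])
    show "(\<lambda>(x, z). alpha \<epsilon> (y - T z) * alpha \<epsilon> (z - x) * f x) \<in> borel_measurable (\<mu> \<Otimes>\<^sub>M lebesgue_on W)"
      by measurable
    show "AE p in \<mu> \<Otimes>\<^sub>M lebesgue_on W. norm (case p of (x, z) \<Rightarrow> alpha \<epsilon> (y - T z) * alpha \<epsilon> (z - x) * f x)
        \<le> norm (case p of (x, z) \<Rightarrow> (c * c) * f x)"
      by (rule AE_I2)
        (use c_pos in \<open>auto simp: abs_mult alpha_nonneg alpha_le_c intro!: mult_mono mult_right_mono\<close>)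
  qed
  have "(\<integral>x. k x y * f x \<partial>\<mu>) =
      (\<integral>x. (\<integral>z. alpha \<epsilon> (y - T z) * alpha \<epsilon> (z - x) * f x \<partial>lebesgue_on W) \<partial>\<mu>)"
    by (simp add: k_eq)
  also have "\<dots> = (\<integral>z. (\<integral>x. alpha \<epsilon> (y - T z) * alpha \<epsilon> (z - x) * f x \<partial>\<mu>) \<partial>lebesgue_on W)"
    using P.Fubini_integral[OF int] by simp
  also have "\<dots> = (\<integral>z. alpha \<epsilon> (y - T z) * F f z \<partial>lebesgue_on W)"
    by (simp add: F_def mult.assoc)
  finally show ?thesis .
qed

lemma k_integral_convergent_subsequence:
  assumes f: "\<And>n. f n \<in> L2 \<mu>" "\<And>n. L2_inner \<mu> (f n) (f n) = 1"
  shows "\<exists>s. strict_mono (s :: nat \<Rightarrow> nat) \<and> (\<forall>y. convergent (\<lambda>n. \<integral>x. k x y * f (s n) x \<partial>\<mu>))"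
proof -
  obtain s where s: "strict_mono (s :: nat \<Rightarrow> nat)" "\<And>z. convergent (\<lambda>n. F (f (s n)) z)"
    using F_convergent_subsequence[of f, OF f] by blast
  have [measurable]: "f n \<in> borel_measurable \<mu>" for n using f by auto
  define G where "G z = lim (\<lambda>n. F (f (s n)) z)" for z
  have lim: "(\<lambda>n. F (f (s n)) z) \<longlonglongrightarrow> G z" for z
    using s(2)[of z] by (simp add: G_def convergent_LIMSEQ_iff)
  have [measurable]: "G \<in> borel_measurable borel"
    by (rule borel_measurable_LIMSEQ_real[OF lim]) auto
  have Fm: "(\<lambda>z. alpha \<epsilon> (y - T z) * g z) \<in> borel_measurable (lebesgue_on W)"
    if "g \<in> borel_measurable borel" for g y
    using measurable_compose[OF id_measurable_lebesgue_on that] by measurable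
  have "(\<lambda>n. \<integral>z. alpha \<epsilon> (y - T z) * F (f (s n)) z \<partial>lebesgue_on W)
      \<longlonglongrightarrow> (\<integral>z. alpha \<epsilon> (y - T z) * G z \<partial>lebesgue_on W)" for y
  proof (rule integral_dominated_convergence)
    show "integrable (lebesgue_on W) (\<lambda>_. c * c)" by simp
    show "AE z in lebesgue_on W. (\<lambda>n. alpha \<epsilon> (y - T z) * F (f (s n)) z) \<longlonglongrightarrow> alpha \<epsilon> (y - T z) * G z"
      by (intro AE_I2 tendsto_intros lim)
    show "AE z in lebesgue_on W. norm (alpha \<epsilon> (y - T z) * F (f (s n)) z) \<le> c * c" for n
      using c_pos F_bound[OF f]
      by (intro AE_I2) (auto simp: abs_mult alpha_nonneg alpha_le_c intro!: mult_mono)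
  qed (auto intro!: Fm)
  then show ?thesis
    using s(1) by (auto simp: integral_k_eq_F f intro!: exI[of _ s] convergentI)
qed

section \<open>The gap estimate for a given pair of test functions\<close>

lemma sigma2_bound:
  assumes f: "f \<in> L2 \<mu>" "L2_inner \<mu> f (\<lambda>_. 1) = 0" "L2_inner \<mu> f f > 0"
    and g: "g \<in> borel_measurable borel" "\<And>y. y \<in> M \<Longrightarrow> \<bar>g y\<bar> \<le> C"
    and d: "\<And>x y. x \<in> X \<Longrightarrow> y \<in> Y \<Longrightarrow> k x y \<noteq> 0 \<Longrightarrow> \<bar>f x - g y\<bar> \<le> d"
  shows "1 - sigma2 X h T \<epsilon> \<le> d\<^sup>2 / L2_inner \<mu> f f"
proof -
  interpret C: compact_markov_operator \<mu> K.nuN K.A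
  proof unfold_locales
    show "\<exists>B. is_L2_adjoint \<mu> K.nuN K.A B" using K.is_adjoint by blast
    \<comment> \<open>The test function itself witnesses that the space is larger than the
      constants.\<close>
    show "\<exists>f\<in>L2 \<mu>. L2_inner \<mu> f (\<lambda>_. 1) = 0 \<and> L2_inner \<mu> f f \<noteq> 0" using f by force
    show "K.A (\<lambda>x. a * f x + b * g x) y = a * K.A f y + b * K.A g y"
      if "f \<in> L2 \<mu>" "g \<in> L2 \<mu>" "y \<in> space K.nuN" for f g a b y
      using that by (intro K.A_linear) (auto simp: K.nuN_def)
    show "\<exists>k G. strict_mono (k :: nat \<Rightarrow> nat) \<and> G \<in> L2 K.nuN \<and>
          (\<forall>H\<in>L2 K.nuN. (\<lambda>n. L2_inner K.nuN (K.A (f (k n))) H) \<longlonglongrightarrow> L2_inner K.nuN G H) \<and>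
          (\<lambda>n. L2_inner K.nuN (K.A (f (k n))) (K.A (f (k n)))) \<longlonglongrightarrow> L2_inner K.nuN G G"
      if f: "\<And>n. f n \<in> L2 \<mu>" "\<And>n. L2_inner \<mu> (f n) (f n) = 1" for f
    proof -
      obtain s where s: "strict_mono (s :: nat \<Rightarrow> nat)"
          "\<And>y. convergent (\<lambda>n. \<integral>x. k x y * f (s n) x \<partial>\<mu>)"
        using k_integral_convergent_subsequence[of f, OF f] by blast
      have "\<exists>G\<in>L2 K.nuN.
          (\<forall>H\<in>L2 K.nuN. (\<lambda>n. L2_inner K.nuN (K.A (f (s n))) H) \<longlonglongrightarrow> L2_inner K.nuN G H) \<and>
          (\<lambda>n. L2_inner K.nuN (K.A (f (s n))) (K.A (f (s n)))) \<longlonglongrightarrow> L2_inner K.nuN G G"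
        by (rule K.pointwise_imp_L2_convergent) (simp_all add: f s(2))
      then obtain G where "G \<in> L2 K.nuN"
          "\<forall>H\<in>L2 K.nuN. (\<lambda>n. L2_inner K.nuN (K.A (f (s n))) H) \<longlonglongrightarrow> L2_inner K.nuN G H"
          "(\<lambda>n. L2_inner K.nuN (K.A (f (s n))) (K.A (f (s n)))) \<longlonglongrightarrow> L2_inner K.nuN G G"
        by (elim bexE conjE) (rule that)
      with s(1) show ?thesis by (intro exI[of _ s] exI[of _ G] conjI)
    qed
  qed (auto simp: K.A_L2_and_contraction K.A_inner_one)
  have gm: "g \<in> borel_measurable (lebesgue_on Y)"
    using measurable_compose[OF id_measurable_lebesgue_on g(1)] by simp
  have "g \<in> L2 K.nuN"
    by (rule K.L2_nuN_bounded[OF gm, of C]) (use g(2) Y_sub in auto)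
  then have "L2_inner \<mu> f f - L2_inner K.nuN (K.A f) (K.A f) \<le> d\<^sup>2"
    by (rule K.energy_le[OF f(1)]) (use d in auto)
  from C.singular_value_2_bound[OF f this]
  have "1 - singular_value \<mu> K.nuN K.A 2 \<le> d\<^sup>2 / L2_inner \<mu> f f" .
  then show ?thesis
    unfolding sigma2_def nu_eq using singular_value_cong[of \<mu> "L_eps X h T \<epsilon>" K.A K.nuN 2] L_eps_eq
    by simp
qed

lemma k_nonzeroD:
  assumes "k x y \<noteq> 0"
  shows "\<exists>z\<in>W. dist y (T z) < \<epsilon> \<and> dist z x < \<epsilon>"
proof (rule ccontr)
  assume "\<not> ?thesis"
  then have "alpha \<epsilon> (y - T z) * alpha \<epsilon> (z - x) = 0" if "z \<in> W" for z
    using that alpha_neq_0D by (metis mult_eq_0_iff)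
  then have "k x y = (\<integral>z. 0 \<partial>lebesgue_on W)"
    unfolding k_eq by (intro Bochner_Integration.integral_cong) auto
  with assms show False by simp
qed

end

section \<open>The spectral gap\<close>

theorem corollary4:
  fixes M X :: "'a::euclidean_space set" and T :: "'a \<Rightarrow> 'a" and h :: "'a \<Rightarrow> real" and eps_star :: real
  assumes "eps_star > 0"
    and "compact M" and "X \<subseteq> M" and "X \<in> sets lebesgue"
    and "T \<in> M \<rightarrow> M" and "T \<in> borel_measurable (lebesgue_on M)"
    and "h \<in> L2 (lebesgue_on X)" and "prob_space (mu X h)"
    and "\<And>\<epsilon>. 0 < \<epsilon> \<Longrightarrow> \<epsilon> \<le> eps_star \<Longrightarrow> X_eps X \<epsilon> \<subseteq> M \<and> Y_eps X T \<epsilon> \<subseteq> M"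
    and "\<And>\<epsilon> x. 0 < \<epsilon> \<Longrightarrow> \<epsilon> \<le> eps_star \<Longrightarrow> x \<in> X \<Longrightarrow> ball x \<epsilon> \<subseteq> X_eps X \<epsilon>"
    and "\<And>\<epsilon> z. 0 < \<epsilon> \<Longrightarrow> \<epsilon> \<le> eps_star \<Longrightarrow> z \<in> X_eps X \<epsilon> \<Longrightarrow> ball (T z) \<epsilon> \<subseteq> Y_eps X T \<epsilon>"
    and "nonsingular_on X T"
    and "\<exists>k. smooth_manifold_with_boundary k (T ` X)"
    and "inj_on T (X_eps X eps_star)"
    and "smooth_on (T ` X_eps X eps_star) (inv_into (X_eps X eps_star) T)"
    and "\<exists>a b. 0 < a \<and> (AE x in lebesgue_on X. a \<le> h x \<and> h x \<le> b)"
  shows "\<exists>C>0. \<forall>\<epsilon>. 0 < \<epsilon> \<and> \<epsilon> < eps_star \<longrightarrow> 1 - sigma2 X h T \<epsilon> \<le> C * \<epsilon>"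
proof -
  have h_meas: "h \<in> borel_measurable (lebesgue_on X)" using assms(7) by auto
  have h_pos: "AE x in lebesgue_on X. 0 < h x"
    using assms(16) by (auto elim!: eventually_mono)
  have transfer: "smoothed_transfer M X T h \<epsilon>" if "0 < \<epsilon>" "\<epsilon> \<le> eps_star" for \<epsilon>
  proof (rule smoothed_transfer.intro)
    show "AE x in lebesgue_on X. 0 \<le> h x" using h_pos by eventually_elim simp
    show "X_eps X \<epsilon> \<subseteq> M" "Y_eps X T \<epsilon> \<subseteq> M" using assms(9)[OF that] by blast+
    show "ball x \<epsilon> \<subseteq> X_eps X \<epsilon>" if "x \<in> X" for x
      using assms(10)[OF _ _ that] \<open>0 < \<epsilon>\<close> \<open>\<epsilon> \<le> eps_star\<close> by blast
    show "ball (T z) \<epsilon> \<subseteq> Y_eps X T \<epsilon>" if "z \<in> X_eps X \<epsilon>" for z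
      using assms(11)[OF _ _ that] \<open>0 < \<epsilon>\<close> \<open>\<epsilon> \<le> eps_star\<close> by blast
  qed (fact that h_meas assms(2-4,6,8))+
  \<comment> \<open>The instance at \<open>eps_star\<close> serves to build the
    \<epsilon>-independent data.\<close>
  interpret S0: smoothed_transfer M X T h eps_star
    by (rule transfer) (use assms(1) in auto)
  have mu_null: False if "AE x in lebesgue_on X. False"
    using S0.AE_mu[OF that] by (simp add: S0.\<mu>.AE_False)
  have X_sub: "X \<subseteq> X_eps X eps_star"
    using S0.ball_W assms(1) by (meson centre_in_ball subset_iff)
  \<comment> \<open>Nonsingularity would pull a null image back to a null \<open>X\<close>, which
    cannot carry a probability with a density.\<close>
  have "\<not> negligible (T ` X)"
  proof
    assume "negligible (T ` X)"
    then have "{x \<in> X. T x \<in> T ` X} \<in> null_sets lebesgue"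
      using assms(12) by (simp add: nonsingular_on_def negligible_iff_null_sets)
    moreover have "{x \<in> X. T x \<in> T ` X} = X" by auto
    ultimately have "AE x in lebesgue. x \<notin> X" using AE_not_in by simp
    then have "AE x in lebesgue_on X. False"
      using assms(4) by (subst AE_restrict_space_iff) auto
    then show False by (rule mu_null)
  qed
  then have "interior (T ` X) \<noteq> {}"
    using assms(13) smooth_manifold_interior_nonempty by blast
  from lipschitz_test_function_exists[OF X_sub assms(14,15) this]
  obtain x0 r K g where r: "r > 0" "ball x0 r \<subseteq> X" and g: "K-lipschitz_on UNIV g"
    and gT: "\<And>z. z \<in> X_eps X eps_star \<Longrightarrow> g (T z) = max 0 (r - dist x0 z)" by blast
  define f where "f x = max 0 (r - dist x0 x)" for x
  define m where "m = (\<integral>x. f x \<partial>mu X h)"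
  have K: "0 \<le> K" using g lipschitz_on_nonneg by blast
  have f_borel: "f \<in> borel_measurable borel"
    unfolding f_def[abs_def] by (intro borel_measurable_continuous_onI continuous_intros)
  have [measurable]: "f \<in> borel_measurable (mu X h)"
    using measurable_compose[OF S0.id_measurable_mu f_borel] by simp
  have f_bound: "\<bar>f x\<bar> \<le> r" for x using r(1) by (simp add: f_def)
  have f_int: "integrable (mu X h) f"
    by (rule S0.\<mu>.integrable_const_bound[where B = r]) (auto simp: f_bound)
  have "norm ((f x)\<^sup>2) \<le> r\<^sup>2" for x
    using power_mono[OF f_bound[of x], of 2] by simp
  then have "integrable (mu X h) (\<lambda>x. (f x)\<^sup>2)"
    by (intro S0.\<mu>.integrable_const_bound[where B = "r\<^sup>2"] AE_I2) measurable
  then have f_L2: "f \<in> L2 (mu X h)" by (simp add: L2_def)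
  \<comment> \<open>Centring makes the test function orthogonal to the constants. Below,
    \<open>g\<close> is shifted by the same \<open>m\<close>, so the difference in the energy is
    unchanged.\<close>
  define f0 where "f0 = (\<lambda>x. 1 * f x + (- m) * 1)"
  have one_L2: "(\<lambda>_. 1) \<in> L2 (mu X h)" by (rule L2_const) unfold_locales
  have f0_L2: "f0 \<in> L2 (mu X h)"
    unfolding f0_def by (rule L2_lincomb[OF f_L2 one_L2])
  have "L2_inner (mu X h) f0 (\<lambda>_. 1) = (\<integral>x. f x - m \<partial>mu X h)"
    by (simp add: L2_inner_def f0_def)
  also have "\<dots> = 0"
    using f_int S0.\<mu>.prob_space by (simp add: m_def)
  finally have f0_orth: "L2_inner (mu X h) f0 (\<lambda>_. 1) = 0" .
  have f0_pos: "L2_inner (mu X h) f0 f0 > 0"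
  proof (rule ccontr)
    assume "\<not> ?thesis"
    then have "L2_inner (mu X h) f0 f0 = 0"
      using L2_inner_self_nonneg[of "mu X h" f0] by simp
    then have "AE x in mu X h. f x = m"
      using L2_inner_self_eq_0_iff[OF f0_L2] by (simp add: f0_def)
    \<comment> \<open>Positivity of the density \<open>h\<close> brings the statement back from
      \<open>\<mu>\<close> to Lebesgue measure.\<close>
    then have "AE x in lebesgue_on X. 0 < ennreal (h x) \<longrightarrow> f x = m"
      unfolding mu_def using h_meas by (subst (asm) AE_density) auto
    with h_pos have "AE x in lebesgue_on X. f x = m"
      by eventually_elim simp
    then have ae: "AE x in lebesgue. x \<in> X \<longrightarrow> f x = m"
      using assms(4) by (subst (asm) AE_restrict_space_iff) auto
    \<comment> \<open>Open set inside the ball on which \<open>f\<close> differs from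
      \<open>m\<close>. It contains the centre unless \<open>r = m\<close>, and in that case a point
      halfway to the boundary.\<close>
    define S where "S = ball x0 r \<inter> {x. dist x0 x \<noteq> r - m}"
    have "open S"
      unfolding S_def by (intro open_Int open_ball open_Collect_neq continuous_intros)
    moreover have "S \<noteq> {}"
    proof (cases "r = m")
      case False
      then have "x0 \<in> S" using r(1) by (simp add: S_def)
      then show ?thesis by blast
    next
      case True
      obtain b :: 'a where b: "b \<in> Basis" using nonempty_Basis by blast
      then have "x0 + (r / 2) *\<^sub>R b \<in> S"
        using r(1) True b nonzero_Basis[OF b] by (simp add: S_def dist_norm)
      then show ?thesis by blast
    qed
    ultimately have "\<not> negligible S" by (rule open_not_negligible)
    moreover have "AE x in lebesgue. x \<notin> S"
      using ae by eventually_elim (use r in \<open>auto simp: S_def f_def\<close>)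
    then have "S \<in> null_sets lebesgue"
      using \<open>open S\<close> by (simp add: AE_iff_null_sets)
    ultimately show False by (simp add: negligible_iff_null_sets)
  qed
  have g_cont: "continuous_on UNIV g" using g lipschitz_on_continuous_on by blast
  then have "compact (g ` M)"
    using assms(2) compact_continuous_image continuous_on_subset by blast
  then have "bounded (g ` M)" by (rule compact_imp_bounded)
  then obtain G where G: "\<And>y. y \<in> M \<Longrightarrow> \<bar>g y\<bar> \<le> G"
    unfolding bounded_iff by auto
  define V where "V = L2_inner (mu X h) f0 f0"
  \<comment> \<open>The factor \<open>eps_star\<close> absorbs one power of \<epsilon> in
    \<open>((1 + K) * \<epsilon>)\<^sup>2 / V\<close>; there 1 is the Lipschitz constant of
    \<open>f\<close> for the first jump, and \<open>K\<close> that of \<open>g\<close> for the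
    second.\<close>
  define C where "C = (1 + K)\<^sup>2 * eps_star / V"
  have "1 - sigma2 X h T \<epsilon> \<le> C * \<epsilon>" if \<epsilon>: "0 < \<epsilon>" "\<epsilon> < eps_star" for \<epsilon>
  proof -
    interpret S: smoothed_transfer M X T h \<epsilon>
      by (rule transfer) (use \<epsilon> in auto)
    have "1 - sigma2 X h T \<epsilon> \<le> ((1 + K) * \<epsilon>)\<^sup>2 / V"
      unfolding V_def
    proof (rule S.sigma2_bound[OF f0_L2 f0_orth f0_pos, of "\<lambda>y. g y - m" "G + \<bar>m\<bar>"])
      show "(\<lambda>y. g y - m) \<in> borel_measurable borel"
        by (intro borel_measurable_continuous_onI continuous_intros g_cont)
      show "\<bar>g y - m\<bar> \<le> G + \<bar>m\<bar>" if "y \<in> M" for y using G[OF that] by simp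
      fix x y assume "S.k x y \<noteq> 0"
      then obtain z where z: "z \<in> X_eps X \<epsilon>" "dist y (T z) < \<epsilon>" "dist z x < \<epsilon>"
        using S.k_nonzeroD by blast
      \<comment> \<open>The intermediate point may lie outside \<open>X\<close>, so
        \<open>g (T z) = f z\<close> is required on the enlarged set.\<close>
      then have "z \<in> X_eps X eps_star" using X_eps_mono[OF assms(4) \<epsilon>(1) less_imp_le[OF \<epsilon>(2)]] by blast
      then have "g (T z) = f z" by (simp add: gT f_def)
      moreover have "\<bar>f x - f z\<bar> \<le> dist z x"
        using dist_triangle[of x0 x z] dist_triangle[of x0 z x] dist_commute[of x z] zero_le_dist[of z x]
        unfolding f_def by linarith
      moreover have "\<bar>g (T z) - g y\<bar> \<le> K * dist (T z) y"
        using lipschitz_onD[OF g, of "T z" y] by (simp add: dist_real_def)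
      moreover have "K * dist (T z) y \<le> K * \<epsilon>"
        using z(2) K by (intro mult_left_mono) (auto simp: dist_commute)
      ultimately have "\<bar>f x - g y\<bar> \<le> \<epsilon> + K * \<epsilon>" using z(3) by linarith
      then show "\<bar>f0 x - (g y - m)\<bar> \<le> (1 + K) * \<epsilon>" by (simp add: f0_def algebra_simps)
    qed
    also have "\<dots> = (1 + K)\<^sup>2 / V * \<epsilon> * \<epsilon>" by (simp add: power2_eq_square)
    also have "\<dots> \<le> (1 + K)\<^sup>2 / V * \<epsilon> * eps_star"
      using \<epsilon> f0_pos by (intro mult_left_mono) (auto simp: V_def)
    also have "\<dots> = C * \<epsilon>" by (simp add: C_def)
    finally show ?thesis .
  qed
  moreover have "C > 0" using K assms(1) f0_pos by (simp add: C_def V_def)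
  ultimately show ?thesis by blast
qed

end
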